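(* Let $T$ be a positive symmetric operator in the real or complex Hilbert space $\mathcal{H}$ with dense domain $\mathcal{D}:=\operatorname{dom}T$. Then there exists a positive self-adjoint operator $T_F$ in $\mathcal{H}$ such that (a) $T\subset T_F$, that is, $T_F$ is a positive self-adjoint extension of $T$; (b) $S\preceq T_F$ for every positive self-adjoint extension $S$ of $T$.
   Context: $(\cdot,\cdot)$ is the inner product of $\mathcal{H}$. Operators are linear and may be unbounded. $T$ is positive symmetric if $(Tg,h)=(g,Th)$ for all $g,h\in\operatorname{dom}T$ and $(Tg,g)\ge0$ for all $g\in\operatorname{dom}T$. For a positive self-adjoint operator $S$, $S^{1/2}$ denotes its unique positive self-adjoint square root. The form order $\preceq$ on positive self-adjoint operators is defined by: $A\preceq B$ if $\operatorname{dom}B^{1/2}\subseteq\operatorname{dom}A^{1/2}$ and $\|A^{1/2}h\|^2\le\|B^{1/2}h\|^2$ for all $h\in\operatorname{dom}B^{1/2}$. *)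

theory Defs
  imports "HOL-Analysis.Analysis"
begin

text \<open>
  Real and complex Hilbert spaces are treated uniformly over a scalar type \<^emph>\<open>'k\<close>. The class below
  is instantiated by \<^typ>\<open>real\<close> (trivial conjugation) and \<^typ>\<open>complex\<close> (usual conjugation); lemma
  \<^emph>\<open>real_or_complex\<close> shows that its axioms leave no other possibility.
\<close>

class rc_field = real_normed_field +
  fixes sconj :: "'a \<Rightarrow> 'a"
  assumes sconj_add: "sconj (x + y) = sconj x + sconj y"
    and sconj_mult: "sconj (x * y) = sconj x * sconj y"
    and mult_sconj_scaleR: "x * sconj x = (norm x)\<^sup>2 *\<^sub>R 1"
    and add_sconj_scaleR: "\<exists>r. x + sconj x = r *\<^sub>R 1"

instantiation real :: rc_field
begin

definition sconj_real :: "real \<Rightarrow> real" where "sconj_real x = x"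

instance
  by standard (simp_all add: sconj_real_def power2_eq_square)

end

instantiation complex :: rc_field
begin

definition sconj_complex :: "complex \<Rightarrow> complex" where "sconj_complex = cnj"

instance
proof
  fix x y :: complex
  show "sconj (x + y) = sconj x + sconj y" "sconj (x * y) = sconj x * sconj y"
    by (simp_all add: sconj_complex_def)
  show "x * sconj x = (norm x)\<^sup>2 *\<^sub>R 1"
    unfolding sconj_complex_def
    by (metis complex_norm_square scaleR_conv_of_real mult.right_neutral)
  show "\<exists>r. x + sconj x = r *\<^sub>R 1"
    unfolding sconj_complex_def
    by (metis complex_add_cnj scaleR_conv_of_real mult.right_neutral)
qed

end

lemma mult_sconj: "x * sconj x = of_real ((norm (x :: 'k::rc_field))\<^sup>2)"
  by (simp add: mult_sconj_scaleR of_real_def del: of_real_power)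

lemma add_sconj_Reals: "(x :: 'k::rc_field) + sconj x \<in> \<real>"
  using add_sconj_scaleR[of x] by (auto simp: Reals_def of_real_def)

lemma sconj_of_real: "sconj (of_real r) = (of_real r :: 'k::rc_field)"
proof (cases "r = 0")
  case True
  then show ?thesis using sconj_add[of 0 "0 :: 'k"] by simp
next
  case False
  have "of_real r * sconj (of_real r) = (of_real r * of_real r :: 'k)"
    using mult_sconj[of "of_real r :: 'k"] by (simp add: power2_eq_square)
  then show ?thesis using False by simp
qed

lemma sconj_minus: "sconj (- x) = - sconj (x :: 'k::rc_field)"
proof -
  have "sconj 0 = (0 :: 'k)"
    using sconj_add[of 0 "0 :: 'k"] by simp
  then show ?thesis
    using sconj_add[of x "- x"] by (simp add: minus_unique)
qed

lemma Reals_if_sconj_eq: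
  fixes x :: "'k::rc_field"
  assumes "sconj x = x"
  shows "x \<in> \<real>"
proof -
  have "x = (x + sconj x) / of_real 2"
    using assms by simp
  then show ?thesis
    using add_sconj_Reals[of x] by (metis Reals_divide Reals_of_real)
qed

lemma sconj_sconj: "sconj (sconj x) = (x :: 'k::rc_field)"
proof -
  obtain r where "x + sconj x = of_real r"
    using add_sconj_Reals[of x] by (auto elim: Reals_cases)
  then have "sconj x + sconj (sconj x) = x + sconj x"
    using sconj_of_real by (metis sconj_add)
  then show ?thesis by (simp add: add.commute)
qed

lemma real_or_complex:
  "(\<forall>z :: 'k::rc_field. z \<in> \<real> \<and> sconj z = z) \<or>
   (\<exists>i :: 'k. i * i = -1 \<and> sconj i = - i \<and> (\<forall>z. \<exists>a b. z = of_real a + of_real b * i))"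
proof (cases "\<forall>z :: 'k. sconj z = z")
  case True
  then show ?thesis using Reals_if_sconj_eq by blast
next
  case False
  then obtain x :: 'k where x: "sconj x \<noteq> x" by blast
  define y where "y = x - sconj x"
  define i where "i = y / of_real (norm y)"
  have ny: "norm y \<noteq> 0" using x by (simp add: y_def)
  have cy: "sconj y = - y"
    unfolding y_def using sconj_add[of x "- sconj x"] by (simp add: sconj_minus sconj_sconj)
  have i_eq: "i = y * of_real (1 / norm y)" by (simp add: i_def field_simps)
  have ci: "sconj i = - i"
    unfolding i_eq sconj_mult sconj_of_real cy by simp
  have "y * y = - of_real ((norm y)\<^sup>2)"
    using mult_sconj[of y] cy by (metis minus_minus mult_minus_right)
  then have ii: "i * i = -1"
    using ny by (simp add: i_def power2_eq_square)
  have "\<exists>a b. z = of_real a + of_real b * i" for z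
  proof -
    define w where "w = z - sconj z"
    have cw: "sconj w = - w"
      unfolding w_def using sconj_add[of z "- sconj z"] by (simp add: sconj_minus sconj_sconj)
    have "sconj (- (w * i)) = - (w * i)"
      by (simp add: sconj_minus sconj_mult cw ci)
    then obtain b where b: "- (w * i) = of_real b"
      using Reals_if_sconj_eq by (metis Reals_cases)
    obtain a where a: "z + sconj z = of_real a"
      using add_sconj_Reals[of z] by (auto elim: Reals_cases)
    have "w = of_real b * i"
      using ii by (simp add: b[symmetric] mult.assoc)
    moreover have "2 * z = (z + sconj z) + w"
      by (simp add: w_def)
    ultimately have "2 * z = of_real a + of_real b * i"
      using a by simp
    then have "z = of_real (a / 2) + of_real (b / 2) * i"
      by (simp add: field_simps)
    then show ?thesis by blast
  qed
  then show ?thesis using ii ci by blast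
qed

text \<open>
  A Hilbert space over \<^emph>\<open>'k\<close>: completeness is the class \<^class>\<open>banach\<close>, whose norm is tied to the inner
  product by \<^emph>\<open>ip_self\<close>. The inner product is linear in its first argument.
\<close>

locale hilbert_space = vector_space smul
  for smul :: "'k::rc_field \<Rightarrow> 'a::banach \<Rightarrow> 'a" +
  fixes ip :: "'a \<Rightarrow> 'a \<Rightarrow> 'k"
  assumes scale_of_real: "smul (of_real r) x = r *\<^sub>R x"
    and ip_add_left: "ip (x + y) z = ip x z + ip y z"
    and ip_scale_left: "ip (smul c x) y = c * ip x y"
    and ip_sconj: "ip y x = sconj (ip x y)"
    and ip_self: "ip x x = of_real ((norm x)\<^sup>2)"

lemma hilbert_space_real:
  "hilbert_space (scaleR :: real \<Rightarrow> 'a::{real_inner,banach} \<Rightarrow> 'a) inner"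
  by unfold_locales
    (simp_all add: sconj_real_def algebra_simps inner_commute power2_norm_eq_inner)

lemma hilbert_space_complex: "hilbert_space (*) (\<lambda>x y :: complex. x * cnj y)"
  by unfold_locales
    (simp_all add: sconj_complex_def algebra_simps scaleR_conv_of_real complex_norm_square
      del: of_real_power)

text \<open>
  A possibly unbounded operator is a partial map, so that its domain is \<^const>\<open>dom\<close>, extension
  \<open>T \<subset> S\<close> is \<^const>\<open>map_le\<close>, and the product on its natural domain is \<^const>\<open>map_comp\<close>.
\<close>

definition linear_operator :: "('k::rc_field \<Rightarrow> 'a::banach \<Rightarrow> 'a) \<Rightarrow> ('a \<rightharpoonup> 'a) \<Rightarrow> bool" where
  "linear_operator smul T \<longleftrightarrow>
     module.subspace smul (dom T) \<and>
     (\<forall>g\<in>dom T. \<forall>h\<in>dom T. the (T (g + h)) = the (T g) + the (T h)) \<and>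
     (\<forall>c. \<forall>g\<in>dom T. the (T (smul c g)) = smul c (the (T g)))"

definition positive_symmetric ::
    "('k::rc_field \<Rightarrow> 'a::banach \<Rightarrow> 'a) \<Rightarrow> ('a \<Rightarrow> 'a \<Rightarrow> 'k) \<Rightarrow> ('a \<rightharpoonup> 'a) \<Rightarrow> bool" where
  "positive_symmetric smul ip T \<longleftrightarrow>
     linear_operator smul T \<and>
     (\<forall>g\<in>dom T. \<forall>h\<in>dom T. ip (the (T g)) h = ip g (the (T h))) \<and>
     (\<forall>g\<in>dom T. \<exists>r\<ge>0. ip (the (T g)) g = of_real r)"

definition densely_defined :: "('a::banach \<rightharpoonup> 'a) \<Rightarrow> bool" where
  "densely_defined T \<longleftrightarrow> closure (dom T) = UNIV"

text \<open>The value of the adjoint is well defined only for densely defined \<open>T\<close>.\<close>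

definition op_adjoint ::
    "('a::banach \<Rightarrow> 'a \<Rightarrow> 'k::rc_field) \<Rightarrow> ('a \<rightharpoonup> 'a) \<Rightarrow> ('a \<rightharpoonup> 'a)" where
  "op_adjoint ip T =
     (\<lambda>h. if \<exists>k. \<forall>g\<in>dom T. ip (the (T g)) h = ip g k
          then Some (THE k. \<forall>g\<in>dom T. ip (the (T g)) h = ip g k)
          else None)"

definition self_adjoint ::
    "('k::rc_field \<Rightarrow> 'a::banach \<Rightarrow> 'a) \<Rightarrow> ('a \<Rightarrow> 'a \<Rightarrow> 'k) \<Rightarrow> ('a \<rightharpoonup> 'a) \<Rightarrow> bool" where
  "self_adjoint smul ip T \<longleftrightarrow>
     linear_operator smul T \<and> densely_defined T \<and> op_adjoint ip T = T"

definition positive_self_adjoint ::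
    "('k::rc_field \<Rightarrow> 'a::banach \<Rightarrow> 'a) \<Rightarrow> ('a \<Rightarrow> 'a \<Rightarrow> 'k) \<Rightarrow> ('a \<rightharpoonup> 'a) \<Rightarrow> bool" where
  "positive_self_adjoint smul ip T \<longleftrightarrow> self_adjoint smul ip T \<and> positive_symmetric smul ip T"

definition op_sqrt ::
    "('k::rc_field \<Rightarrow> 'a::banach \<Rightarrow> 'a) \<Rightarrow> ('a \<Rightarrow> 'a \<Rightarrow> 'k) \<Rightarrow> ('a \<rightharpoonup> 'a) \<Rightarrow> ('a \<rightharpoonup> 'a)" where
  "op_sqrt smul ip S = (THE R. positive_self_adjoint smul ip R \<and> R \<circ>\<^sub>m R = S)"

definition form_le ::
    "('k::rc_field \<Rightarrow> 'a::banach \<Rightarrow> 'a) \<Rightarrow> ('a \<Rightarrow> 'a \<Rightarrow> 'k) \<Rightarrow> ('a \<rightharpoonup> 'a) \<Rightarrow> ('a \<rightharpoonup> 'a) \<Rightarrow> bool" where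
  "form_le smul ip A B \<longleftrightarrow>
     dom (op_sqrt smul ip B) \<subseteq> dom (op_sqrt smul ip A) \<and>
     (\<forall>h\<in>dom (op_sqrt smul ip B).
        (norm (the (op_sqrt smul ip A h)))\<^sup>2 \<le> (norm (the (op_sqrt smul ip B h)))\<^sup>2)"

end

theory Submission imports Defs begin

text \<open>
  The extension is Friedrichs' extension \<open>F\<close>: the restriction of the adjoint of \<open>T\<close> to those \<open>u\<close> that
  are limits of vectors \<open>x\<^sub>n\<close> of \<open>dom T\<close> which are Cauchy for the form \<open>t(x) = (Tx, x)\<close>. Approximating
  sequences show that \<open>F\<close> is symmetric and positive with \<open>(Fu, u) = lim t(x\<^sub>n)\<close>
  (\<open>friedrichs_form_limit\<close>). Minimizing the energy \<open>t(x) + \<parallel>x\<parallel>\<^sup>2 - 2 Re (f, x)\<close> over \<open>dom T\<close> gives, for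
  every \<open>f\<close>, a solution of \<open>Fu + u = f\<close> (\<open>friedrichs_surjective\<close>); a positive symmetric operator with
  this property is self-adjoint.

  If \<open>S\<close> is a positive self-adjoint extension of \<open>T\<close> with square root \<open>L\<close>, and \<open>K\<close> is the square root of
  \<open>F\<close>, then \<open>\<parallel>Lx\<parallel>\<^sup>2 = t(x) = \<parallel>Kx\<parallel>\<^sup>2\<close> on \<open>dom T\<close>. Since \<open>L\<close> is closed, the definition of \<open>dom F\<close> carries
  \<open>\<parallel>Lu\<parallel> = \<parallel>Ku\<parallel>\<close> to \<open>dom F\<close> (\<open>friedrichs_form_eq\<close>), and because \<open>dom F = dom K\<^sup>2\<close> is a core of \<open>K\<close>
  (\<open>root_core\<close>) to all of \<open>dom K\<close> (\<open>friedrichs_root_maximal\<close>).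

  Square roots of unbounded operators come without the spectral theorem from the resolvent
  \<open>A = (1 + S)\<^sup>-\<^sup>1\<close>. It satisfies \<open>0 \<le> A \<le> 1\<close>, and the graph of \<open>S\<close> is the set of all pairs
  \<open>(Az, (1 - A)z)\<close>. The commuting bounded roots \<open>P\<close> of \<open>A\<close> and \<open>Q\<close> of \<open>1 - A\<close> satisfy \<open>P\<^sup>2 + Q\<^sup>2 = 1\<close>, and the
  pairs \<open>(Px, Qx)\<close> form the graph of the root of \<open>S\<close> (\<open>cos_sin_pair_relation\<close>). Any root \<open>R\<close> with resolvent
  \<open>C\<close> commutes with \<open>P\<close> and \<open>Q\<close>, and \<open>QC\<close> and \<open>P(1 - C)\<close> are positive roots of the same bounded operator,
  hence equal, which forces \<open>R\<close> to be the root just constructed (\<open>positive_sa_rel_root\<close>).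

  All of this uses only the real part of the inner product, and it is carried out for graphs, that
  is, for real linear subspaces of \<open>H \<times> H\<close>. The scalar field enters only through the requirement
  that graphs be invariant under multiplication by scalars; the constructions above preserve this.
\<close>


section \<open>Real Hilbert spaces\<close>

lemma discriminant_le:
  fixes a b c :: real
  assumes "\<And>r. 0 \<le> a + 2 * r * b + r\<^sup>2 * c" and "0 \<le> c"
  shows "b\<^sup>2 \<le> a * c"
proof (cases "c = 0")
  case True
  show ?thesis
  proof (cases "b = 0")
    case False
    then show ?thesis
      \<comment> \<open>at this point the affine function takes the value -1\<close>
      using assms(1)[of "- (a + 1) / (2 * b)"] True by (simp add: field_simps)
  qed (simp add: True)
next
  case False
  then have "0 \<le> c * (a + 2 * (- b / c) * b + (- b / c)\<^sup>2 * c)"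
    using assms(1)[of "- b / c"] assms(2) by (intro mult_nonneg_nonneg)
  also have "\<dots> = a * c - b\<^sup>2"
    using False by (simp add: field_simps power2_eq_square)
  finally show ?thesis by simp
qed

text \<open>
  The norm of \<^typ>\<open>'a\<close> is given beforehand, and its real inner product is to be the real part of a
  scalar-valued one. A locale parameter is therefore used instead of the class \<^class>\<open>real_inner\<close>.
\<close>

locale real_hilbert =
  fixes rip :: "'a::banach \<Rightarrow> 'a \<Rightarrow> real"
  assumes rip_add_left: "rip (x + y) z = rip x z + rip y z"
    and rip_scaleR_left: "rip (r *\<^sub>R x) y = r * rip x y"
    and rip_commute: "rip x y = rip y x"
    and rip_self: "rip x x = (norm x)\<^sup>2"
begin

lemma rip_add_right: "rip z (x + y) = rip z x + rip z y"
  by (metis rip_add_left rip_commute)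

lemma rip_scaleR_right: "rip x (r *\<^sub>R y) = r * rip x y"
  by (metis rip_scaleR_left rip_commute)

lemma Cauchy_Schwarz: "\<bar>rip x y\<bar> \<le> norm x * norm y"
proof -
  have "0 \<le> (norm x)\<^sup>2 + 2 * r * rip x y + r\<^sup>2 * (norm y)\<^sup>2" for r
  proof -
    have "0 \<le> rip (x + r *\<^sub>R y) (x + r *\<^sub>R y)"
      by (simp add: rip_self)
    also have "\<dots> = (norm x)\<^sup>2 + 2 * r * rip x y + r\<^sup>2 * (norm y)\<^sup>2"
      unfolding rip_self[symmetric]
      by (simp add: rip_add_left rip_add_right rip_scaleR_left rip_scaleR_right
          rip_commute[of y x] power2_eq_square algebra_simps)
    finally show ?thesis .
  qed
  from discriminant_le[OF this] have "(rip x y)\<^sup>2 \<le> (norm x * norm y)\<^sup>2"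
    by (simp add: power_mult_distrib)
  then have "\<bar>rip x y\<bar> \<le> \<bar>norm x * norm y\<bar>"
    using abs_le_square_iff by blast
  then show ?thesis by simp
qed

sublocale rip: bounded_bilinear rip
proof
  show "\<exists>K. \<forall>a b. norm (rip a b) \<le> norm a * norm b * K"
    using Cauchy_Schwarz by (intro exI[of _ 1]) simp
qed (simp_all add: rip_add_left rip_add_right rip_scaleR_left rip_scaleR_right)

lemma orthogonal_to_dense_eq_0:
  assumes "closure D = UNIV" and "\<And>x. x \<in> D \<Longrightarrow> rip x w = 0"
  shows "w = 0"
proof -
  obtain s where s: "\<And>n. s n \<in> D" "s \<longlonglongrightarrow> w"
    using assms(1) closure_sequential[of w D] by blast
  have "(\<lambda>n. rip (s n) w) \<longlonglongrightarrow> rip w w"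
    by (intro rip.tendsto s tendsto_const)
  moreover have "(\<lambda>n. rip (s n) w) = (\<lambda>n. 0)"
    using s(1) assms(2) by simp
  ultimately have "rip w w = 0"
    by (metis LIMSEQ_unique tendsto_const)
  then show ?thesis by (simp add: rip_self)
qed


section \<open>Square roots of bounded operators\<close>

definition selfadj :: "('a \<Rightarrow>\<^sub>L 'a) \<Rightarrow> bool" where
  "selfadj X \<longleftrightarrow> (\<forall>x y. rip (X x) y = rip x (X y))"

lemma selfadjD: "selfadj X \<Longrightarrow> rip (X x) y = rip x (X y)"
  by (simp add: selfadj_def)

lemma selfadj_limit:
  assumes "\<And>n. selfadj (Y n)" and "Y \<longlonglongrightarrow> L"
  shows "selfadj L"
  unfolding selfadj_def
proof (intro allI)
  fix x y
  have "(\<lambda>n. rip (Y n x) y) \<longlonglongrightarrow> rip (L x) y" "(\<lambda>n. rip x (Y n y)) \<longlonglongrightarrow> rip x (L y)"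
    by (intro rip.tendsto blinfun.tendsto assms tendsto_const)+
  moreover have "(\<lambda>n. rip (Y n x) y) = (\<lambda>n. rip x (Y n y))"
    using assms(1) by (simp add: selfadj_def)
  ultimately show "rip (L x) y = rip x (L y)"
    by (metis LIMSEQ_unique)
qed

abbreviation commutes :: "('a \<Rightarrow>\<^sub>L 'a) \<Rightarrow> ('a \<Rightarrow>\<^sub>L 'a) \<Rightarrow> bool" where
  "commutes X Y \<equiv> (\<forall>x. X (Y x) = Y (X x))"

lemma commutes_limit:
  assumes "\<And>n. commutes M (Y n)" and "Y \<longlonglongrightarrow> L"
  shows "commutes M L"
proof
  fix x
  have "(\<lambda>n. M (Y n x)) \<longlonglongrightarrow> M (L x)" "(\<lambda>n. Y n (M x)) \<longlonglongrightarrow> L (M x)"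
    by (intro blinfun.tendsto assms tendsto_const)+
  moreover have "(\<lambda>n. M (Y n x)) = (\<lambda>n. Y n (M x))"
    using assms(1) by simp
  ultimately show "M (L x) = L (M x)"
    by (metis LIMSEQ_unique)
qed

text \<open>
  The condition \<open>\<parallel>1 - X\<parallel> \<le> 1\<close> is a convenient form of \<open>0 \<le> X \<le> 2\<close> for self-adjoint \<open>X\<close>: it is what the
  iteration for the square root consumes, and the root that it produces satisfies it again.
\<close>

definition unit_positive :: "('a \<Rightarrow>\<^sub>L 'a) \<Rightarrow> bool" where
  "unit_positive X \<longleftrightarrow> selfadj X \<and> norm (id_blinfun - X) \<le> 1"

text \<open>
  A fixed point \<open>L = (B + L\<^sup>2) / 2\<close> satisfies \<open>(1 - L)\<^sup>2 = 1 - B\<close>, so with \<open>B = 1 - A\<close> the operator \<open>1 - L\<close> is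
  a square root of \<open>A\<close>.
\<close>

fun root_iter :: "('a \<Rightarrow>\<^sub>L 'a) \<Rightarrow> nat \<Rightarrow> ('a \<Rightarrow>\<^sub>L 'a)" where
  "root_iter B 0 = 0"
| "root_iter B (Suc n) = (1 / 2) *\<^sub>R (B + (root_iter B n o\<^sub>L root_iter B n))"

text \<open>
  The same iteration for the number 1 in place of \<open>B\<close>. It increases and is bounded by 1, and it
  dominates the increments of the operator iteration, which makes that iteration converge in norm.
\<close>

fun majorant :: "nat \<Rightarrow> real" where
  "majorant 0 = 0"
| "majorant (Suc n) = (1 + (majorant n)\<^sup>2) / 2"

lemma majorant_bounds: "0 \<le> majorant n" "majorant n \<le> 1"
proof -
  have "0 \<le> majorant n \<and> majorant n \<le> 1"
  proof (induction n)
    case (Suc n)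
    then have "(majorant n)\<^sup>2 \<le> 1" by (simp add: power_le_one)
    then show ?case by simp
  qed simp
  then show "0 \<le> majorant n" "majorant n \<le> 1" by simp_all
qed

lemma majorant_mono: "majorant n \<le> majorant (Suc n)"
proof -
  have "0 \<le> (1 - majorant n)\<^sup>2" by simp
  then show ?thesis by (simp add: power2_eq_square algebra_simps)
qed

text \<open>
  Writing \<open>Z\<^sup>2 - Y\<^sup>2 = Z (Z - Y) + (Z - Y) Y\<close> bounds the norm of each increment of the operators by the
  corresponding expression in the norms, which is the increment of the scalar iteration.
\<close>

lemma root_iter_bounds:
  assumes "norm B \<le> 1"
  shows "norm (root_iter B n) \<le> majorant n"
    and "norm (root_iter B (Suc n) - root_iter B n) \<le> majorant (Suc n) - majorant n"
proof -
  have norm_le: "norm (root_iter B n) \<le> majorant n" for n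
  proof (induction n)
    case (Suc n)
    have "norm (root_iter B n o\<^sub>L root_iter B n) \<le> majorant n * majorant n"
      by (rule order_trans[OF norm_blinfun_compose]) (intro mult_mono Suc majorant_bounds norm_ge_zero)
    then show ?case
      using assms norm_triangle_ineq[of B "root_iter B n o\<^sub>L root_iter B n"]
      by (simp add: power2_eq_square)
  qed simp
  then show "norm (root_iter B n) \<le> majorant n" .
  show "norm (root_iter B (Suc n) - root_iter B n) \<le> majorant (Suc n) - majorant n"
  proof (induction n)
    case 0
    then show ?case using assms by simp
  next
    case (Suc n)
    let ?Y = "root_iter B n" and ?Z = "root_iter B (Suc n)"
    let ?a = "majorant n" and ?b = "majorant (Suc n)"
    have "(1 / 2) *\<^sub>R (B + (Z o\<^sub>L Z)) - (1 / 2) *\<^sub>R (B + (Y o\<^sub>L Y))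
        = (1 / 2) *\<^sub>R ((Z o\<^sub>L (Z - Y)) + ((Z - Y) o\<^sub>L Y))" for Y Z
      by (rule blinfun_eqI)
        (simp add: blinfun.bilinear_simps flip: scaleR_diff_right)
    then have eq: "root_iter B (Suc (Suc n)) - ?Z
        = (1 / 2) *\<^sub>R ((?Z o\<^sub>L (?Z - ?Y)) + ((?Z - ?Y) o\<^sub>L ?Y))"
      by (metis root_iter.simps(2))
    have "norm (?Z o\<^sub>L (?Z - ?Y)) \<le> ?b * (?b - ?a)"
      by (rule order_trans[OF norm_blinfun_compose])
        (intro mult_mono norm_le Suc majorant_bounds norm_ge_zero)
    moreover have "norm ((?Z - ?Y) o\<^sub>L ?Y) \<le> (?b - ?a) * ?a"
      using majorant_mono[of n]
      by (intro order_trans[OF norm_blinfun_compose] mult_mono norm_le Suc norm_ge_zero)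
        (simp del: majorant.simps)
    ultimately have "norm ((?Z o\<^sub>L (?Z - ?Y)) + ((?Z - ?Y) o\<^sub>L ?Y)) \<le> ?b * (?b - ?a) + (?b - ?a) * ?a"
      by (intro order_trans[OF norm_triangle_ineq]) (rule add_mono)
    then have "norm (root_iter B (Suc (Suc n)) - ?Z) \<le> (?b * (?b - ?a) + (?b - ?a) * ?a) / 2"
      unfolding eq by (simp del: root_iter.simps majorant.simps)
    also have "\<dots> = ((1 + ?b\<^sup>2) / 2) - ((1 + ?a\<^sup>2) / 2)"
      by (simp add: power2_eq_square field_simps del: majorant.simps)
    also have "\<dots> = majorant (Suc (Suc n)) - ?b"
      by (simp only: majorant.simps(2))
    finally show ?case .
  qed
qed

lemma root_iter_convergent:
  assumes "norm B \<le> 1"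
  shows "convergent (root_iter B)"
proof -
  have diff: "norm (root_iter B (n + k) - root_iter B n) \<le> majorant (n + k) - majorant n" for n k
  proof (induction k)
    case (Suc k)
    have "norm (root_iter B (n + Suc k) - root_iter B n)
        \<le> norm (root_iter B (Suc (n + k)) - root_iter B (n + k)) + norm (root_iter B (n + k) - root_iter B n)"
      using norm_triangle_ineq[of "root_iter B (Suc (n + k)) - root_iter B (n + k)"
          "root_iter B (n + k) - root_iter B n"]
      by (simp del: root_iter.simps)
    then show ?case
      using Suc root_iter_bounds(2)[OF assms, of "n + k"]
      by (simp del: root_iter.simps majorant.simps)
  qed simp
  have "incseq majorant"
    by (rule incseq_SucI) (rule majorant_mono)
  then have "convergent majorant"
    using majorant_bounds by (intro Bseq_mono_convergent) (auto simp: incseq_def intro!: BseqI'[of _ 1])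
  then have "Cauchy majorant"
    by (rule convergent_Cauchy)
  have "Cauchy (root_iter B)"
  proof (rule CauchyI')
    fix e :: real
    assume "0 < e"
    then obtain N where N: "\<And>m n. m \<ge> N \<Longrightarrow> n \<ge> N \<Longrightarrow> norm (majorant m - majorant n) < e"
      using CauchyD[OF \<open>Cauchy majorant\<close>] by blast
    have "norm (root_iter B m - root_iter B n) < e" if mn: "N \<le> m" "m < n" for m n
    proof -
      obtain k where k: "n = m + k" using mn(2) less_imp_add_positive by blast
      have "norm (root_iter B m - root_iter B n) \<le> majorant n - majorant m"
        using diff[of m k] by (simp add: k norm_minus_commute)
      also have "\<dots> < e"
        using N[of n m] mn by simp
      finally show ?thesis .
    qed
    then show "\<exists>M. \<forall>m\<ge>M. \<forall>n>m. dist (root_iter B m) (root_iter B n) < e"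
      unfolding dist_norm by blast
  qed
  then show ?thesis by (rule Cauchy_convergent)
qed

text \<open>
  The iterates are polynomials in \<open>A\<close>, so self-adjointness and commutation with everything that
  commutes with \<open>A\<close> pass to them and then to their limit.
\<close>

lemma unit_positive_root:
  assumes "unit_positive A"
  obtains P where "unit_positive P" and "\<And>x. P (P x) = A x"
    and "\<And>M. commutes M A \<Longrightarrow> commutes M P"
proof -
  define B where "B = id_blinfun - A"
  have sa: "selfadj A" and nB: "norm B \<le> 1"
    using assms by (simp_all add: unit_positive_def B_def)
  obtain L where L: "root_iter B \<longlonglongrightarrow> L"
    using root_iter_convergent[OF nB] by (auto simp: convergent_def)
  have "selfadj (root_iter B n)" for n
  proof (induction n)
    case (Suc n)
    then show ?case
      using sa by (simp add: selfadj_def B_def blinfun.bilinear_simps rip.add_left rip.add_right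
          rip.diff_left rip.diff_right rip.scaleR_left rip.scaleR_right)
  qed (simp add: selfadj_def rip.zero_left rip.zero_right)
  then have saL: "selfadj L"
    using L by (rule selfadj_limit)
  have nL: "norm L \<le> 1"
  proof (rule LIMSEQ_le_const2)
    show "(\<lambda>n. norm (root_iter B n)) \<longlonglongrightarrow> norm L"
      using L by (rule tendsto_norm)
    show "\<exists>N. \<forall>n\<ge>N. norm (root_iter B n) \<le> 1"
      using root_iter_bounds(1)[OF nB] majorant_bounds(2) order_trans by blast
  qed
  have comm: "commutes M L" if M: "commutes M A" for M
  proof (rule commutes_limit[OF _ L])
    fix n
    show "commutes M (root_iter B n)"
      by (induction n) (simp_all add: B_def blinfun.bilinear_simps M)
  qed
  have "(\<lambda>n. root_iter B (Suc n)) \<longlonglongrightarrow> (1 / 2) *\<^sub>R (B + (L o\<^sub>L L))"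
    unfolding root_iter.simps
    by (intro tendsto_intros bounded_bilinear.tendsto[OF bounded_bilinear_blinfun_compose] L)
  then have "L = (1 / 2) *\<^sub>R (B + (L o\<^sub>L L))"
    using LIMSEQ_Suc[OF L] LIMSEQ_unique by blast
  then have "2 *\<^sub>R L = 2 *\<^sub>R ((1 / 2) *\<^sub>R (B + (L o\<^sub>L L)))"
    by (rule arg_cong)
  then have fix_eq: "2 *\<^sub>R L = B + (L o\<^sub>L L)"
    by simp
  show ?thesis
  proof (rule that[of "id_blinfun - L"])
    show "unit_positive (id_blinfun - L)"
      using saL nL by (simp add: unit_positive_def selfadj_def blinfun.bilinear_simps
          rip.diff_left rip.diff_right)
    show "commutes M (id_blinfun - L)" if "commutes M A" for M
      using comm[OF that] by (simp add: blinfun.bilinear_simps)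
    fix x
    have "2 *\<^sub>R L x = x - A x + L (L x)"
      using arg_cong[OF fix_eq, of "\<lambda>Z. blinfun_apply Z x"] by (simp add: B_def blinfun.bilinear_simps)
    then have "A x = x + L (L x) - 2 *\<^sub>R L x" by simp
    then show "(id_blinfun - L) ((id_blinfun - L) x) = A x"
      by (simp add: blinfun.bilinear_simps scaleR_2)
  qed
qed

text \<open>
  Roots of commuting operators commute, so their product is self-adjoint and squares to \<open>XY\<close>. Being
  the square of a self-adjoint operator is how positivity of products is expressed here.
\<close>

lemma commuting_product_root:
  assumes "unit_positive X" "unit_positive Y" and "commutes X Y"
  obtains Z where "selfadj Z" and "\<And>x. Z (Z x) = X (Y x)"
proof -
  obtain p where p: "unit_positive p" "\<And>x. p (p x) = X x" "\<And>M. commutes M X \<Longrightarrow> commutes M p"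
    using unit_positive_root[OF assms(1)] by blast
  obtain q where q: "unit_positive q" "\<And>x. q (q x) = Y x" "\<And>M. commutes M Y \<Longrightarrow> commutes M q"
    using unit_positive_root[OF assms(2)] by blast
  have "commutes Y p" using p(3) assms(3) by simp
  then have pq: "commutes p q" using q(3) by simp
  show ?thesis
  proof (rule that[of "p o\<^sub>L q"])
    show "selfadj (p o\<^sub>L q)"
      using p(1) q(1) pq by (simp add: selfadj_def unit_positive_def)
    show "(p o\<^sub>L q) ((p o\<^sub>L q) x) = X (Y x)" for x
      using pq by (simp add: p(2)[symmetric] q(2)[symmetric])
  qed
qed

lemma selfadj_square_nonneg:
  fixes X Z :: "'a \<Rightarrow>\<^sub>L 'a"
  assumes "selfadj Z" and "\<And>x. Z (Z x) = X x"
  shows "0 \<le> rip (X x) x" and "rip (X x) x = 0 \<Longrightarrow> X x = 0"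
proof -
  have "rip (X x) x = (norm (Z x))\<^sup>2"
    using assms by (metis rip_self selfadjD)
  then show "0 \<le> rip (X x) x" "rip (X x) x = 0 \<Longrightarrow> X x = 0"
    using assms(2)[of x] by (auto simp: blinfun.bilinear_simps)
qed

text \<open>
  Commutation gives \<open>(X + Y)(X - Y) = 0\<close>. For \<open>w = (X - Y) x\<close> the nonnegative numbers \<open>(Xw, w)\<close> and
  \<open>(Yw, w)\<close> therefore add up to 0, so that \<open>Xw = Yw = 0\<close> and \<open>\<parallel>w\<parallel>\<^sup>2 = (x, (X - Y) w) = 0\<close>.
\<close>

lemma positive_root_unique:
  fixes X Y Z W :: "'a \<Rightarrow>\<^sub>L 'a"
  assumes "selfadj Z" "\<And>x. Z (Z x) = X x" and "selfadj W" "\<And>x. W (W x) = Y x"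
    and comm: "commutes X Y" and sq: "\<And>x. X (X x) = Y (Y x)"
  shows "X x = Y x"
proof -
  define w where "w = X x - Y x"
  have "X w + Y w = 0"
    using comm sq by (simp add: w_def blinfun.bilinear_simps)
  then have "rip (X w) w + rip (Y w) w = 0"
    by (metis rip.add_left rip.zero_left)
  moreover have "0 \<le> rip (X w) w" "0 \<le> rip (Y w) w"
    using selfadj_square_nonneg(1) assms(1-4) by blast+
  ultimately have "rip (X w) w = 0" "rip (Y w) w = 0"
    by linarith+
  then have 0: "X w = 0" "Y w = 0"
    using selfadj_square_nonneg(2) assms(1-4) by blast+
  have sa: "rip (X u) v = rip u (X v)" "rip (Y u) v = rip u (Y v)" for u v
    using assms(1-4) by (metis selfadjD)+
  have "rip w w = rip x (X w - Y w)"
    by (subst (1) w_def) (simp add: rip.diff_left rip.diff_right sa)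
  then have "rip w w = 0"
    by (simp add: 0 rip.zero_right)
  then show ?thesis
    by (simp add: w_def rip_self)
qed


section \<open>Friedrichs' extension of a positive linear relation\<close>

text \<open>
  For the graph of a densely defined operator this is the graph of the adjoint. Sets of pairs, which
  need not be single-valued, are used because taking the adjoint is a total operation on them.
\<close>

definition adjoint_rel :: "('a \<times> 'a) set \<Rightarrow> ('a \<times> 'a) set" where
  "adjoint_rel G = {(u, v). \<forall>(x, y)\<in>G. rip y u = rip x v}"

lemma adjointD: "(u, v) \<in> adjoint_rel G \<Longrightarrow> (x, y) \<in> G \<Longrightarrow> rip y u = rip x v"
  by (auto simp: adjoint_rel_def)

lemma adjointI: "(\<And>x y. (x, y) \<in> G \<Longrightarrow> rip y u = rip x v) \<Longrightarrow> (u, v) \<in> adjoint_rel G"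
  by (auto simp: adjoint_rel_def)

lemma adjoint_antimono: "G \<subseteq> H \<Longrightarrow> adjoint_rel H \<subseteq> adjoint_rel G"
  by (auto simp: adjoint_rel_def)

lemma subspace_adjoint: "subspace (adjoint_rel G)"
  by (fastforce simp: adjoint_rel_def subspace_def zero_prod_def rip.zero_right rip.add_right
      rip.scaleR_right)

lemma adjoint_closed:
  assumes "\<And>n. (X n, Y n) \<in> adjoint_rel G" and "X \<longlonglongrightarrow> u" "Y \<longlonglongrightarrow> v"
  shows "(u, v) \<in> adjoint_rel G"
proof (rule adjointI)
  fix x y
  assume xy: "(x, y) \<in> G"
  have "(\<lambda>n. rip y (X n)) \<longlonglongrightarrow> rip y u" "(\<lambda>n. rip x (Y n)) \<longlonglongrightarrow> rip x v"
    by (intro rip.tendsto tendsto_const assms)+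
  moreover have "(\<lambda>n. rip y (X n)) = (\<lambda>n. rip x (Y n))"
    using assms(1) xy adjointD by blast
  ultimately show "rip y u = rip x v"
    by (metis LIMSEQ_unique)
qed

lemma subspace_pair_add:
  "subspace G \<Longrightarrow> (x, y) \<in> G \<Longrightarrow> (x', y') \<in> G \<Longrightarrow> (x + x', y + y') \<in> (G :: ('a \<times> 'a) set)"
  using subspace_add[of G "(x, y)" "(x', y')"] by simp

lemma subspace_pair_diff:
  "subspace G \<Longrightarrow> (x, y) \<in> G \<Longrightarrow> (x', y') \<in> G \<Longrightarrow> (x - x', y - y') \<in> (G :: ('a \<times> 'a) set)"
  using subspace_diff[of G "(x, y)" "(x', y')"] by simp

lemma subspace_pair_scale:
  "subspace G \<Longrightarrow> (x, y) \<in> G \<Longrightarrow> (r *\<^sub>R x, r *\<^sub>R y) \<in> (G :: ('a \<times> 'a) set)"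
  using subspace_scale[of G "(x, y)" r] by simp

definition positive_rel :: "('a \<times> 'a) set \<Rightarrow> bool" where
  "positive_rel G \<longleftrightarrow> subspace G \<and> G \<subseteq> adjoint_rel G \<and> (\<forall>(x, y)\<in>G. 0 \<le> rip y x)"

definition positive_sa_rel :: "('a \<times> 'a) set \<Rightarrow> bool" where
  "positive_sa_rel G \<longleftrightarrow> positive_rel G \<and> adjoint_rel G = G"

lemma positive_relD:
  assumes "positive_rel G"
  shows "subspace G"
    and "(x, y) \<in> G \<Longrightarrow> (x', y') \<in> G \<Longrightarrow> rip y x' = rip x y'"
    and "(x, y) \<in> G \<Longrightarrow> 0 \<le> rip y x"
  using assms by (auto simp: positive_rel_def dest: adjointD)

text \<open>
  The Cauchy-Schwarz inequality for the form \<open>t((x, y), (x', y')) = (y, x')\<close>, which is symmetric and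
  nonnegative on \<open>G\<close>.
\<close>

lemma positive_rel_Cauchy_Schwarz:
  assumes G: "positive_rel G" and s: "(x, y) \<in> G" and t: "(x', y') \<in> G"
  shows "(rip y x')\<^sup>2 \<le> rip y x * rip y' x'"
proof (rule discriminant_le)
  note sym = positive_relD(2)[OF G]
  fix r
  have "(x + r *\<^sub>R x', y + r *\<^sub>R y') \<in> G"
    by (intro subspace_pair_add subspace_pair_scale positive_relD(1)[OF G] s t)
  then have "0 \<le> rip (y + r *\<^sub>R y') (x + r *\<^sub>R x')"
    by (rule positive_relD(3)[OF G])
  also have "\<dots> = rip y x + 2 * r * rip y x' + r\<^sup>2 * rip y' x'"
    using sym[OF s t] by (simp add: rip_add_left rip_add_right rip_scaleR_left rip_scaleR_right
        rip_commute[of y' x] power2_eq_square algebra_simps)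
  finally show "0 \<le> rip y x + 2 * r * rip y x' + r\<^sup>2 * rip y' x'" .
qed (rule positive_relD(3)[OF G t])

text \<open>
  The sequence of pairs approximates \<open>u\<close> in the form norm: the first components converge to \<open>u\<close>, and
  the pairs are Cauchy for the form.
\<close>

definition form_approx :: "('a \<times> 'a) set \<Rightarrow> (nat \<Rightarrow> 'a) \<Rightarrow> (nat \<Rightarrow> 'a) \<Rightarrow> 'a \<Rightarrow> bool" where
  "form_approx G X Y u \<longleftrightarrow> (\<forall>n. (X n, Y n) \<in> G) \<and> X \<longlonglongrightarrow> u \<and>
     (\<forall>e>0. \<exists>N. \<forall>m\<ge>N. \<forall>n\<ge>N. rip (Y m - Y n) (X m - X n) < e)"

lemma form_approx_bounded:
  assumes G: "positive_rel G" and "form_approx G X Y u"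
  obtains N K where "0 < K" "\<And>n. n \<ge> N \<Longrightarrow> rip (Y n) (X n) \<le> K"
proof -
  have XY: "(X n, Y n) \<in> G" for n
    using assms(2) by (simp add: form_approx_def)
  obtain N where N: "\<And>m n. m \<ge> N \<Longrightarrow> n \<ge> N \<Longrightarrow> rip (Y m - Y n) (X m - X n) < 1"
    using assms(2) unfolding form_approx_def by (meson zero_less_one)
  let ?K = "2 + 2 * rip (Y N) (X N)"
  show ?thesis
  proof (rule that[of ?K N])
    show "0 < ?K" using positive_relD(3)[OF G XY[of N]] by simp
    fix n
    assume "n \<ge> N"
    let ?x = "X n - X N" and ?y = "Y n - Y N"
    have "(?x - X N, ?y - Y N) \<in> G"
      by (intro subspace_pair_diff positive_relD(1)[OF G] XY)
    then have "0 \<le> rip (?y - Y N) (?x - X N)"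
      by (rule positive_relD(3)[OF G])
    then have "rip (Y n) (X n) \<le> 2 * rip ?y ?x + 2 * rip (Y N) (X N)"
      by (simp add: rip.diff_left rip.diff_right)
    then show "rip (Y n) (X n) \<le> ?K"
      using N[OF \<open>n \<ge> N\<close> order_refl] by simp
  qed
qed

text \<open>
  The adjoint restricted to the form domain, that is, to the completion of the domain of \<open>G\<close> in the
  form norm, viewed as a set of vectors.
\<close>

definition friedrichs :: "('a \<times> 'a) set \<Rightarrow> ('a \<times> 'a) set" where
  "friedrichs G = {(u, g) \<in> adjoint_rel G. \<exists>X Y. form_approx G X Y u}"

text \<open>
  By symmetry the difference of \<open>(Y\<^sub>n, X'\<^sub>n)\<close> and \<open>(g, X'\<^sub>n)\<close> equals \<open>(X\<^sub>n - u, Y'\<^sub>n)\<close>, the limit for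
  \<open>m \<rightarrow> \<infinity>\<close> of \<open>(X\<^sub>n - X\<^sub>m, Y'\<^sub>n)\<close>. The Cauchy-Schwarz inequality for the form makes this small: the
  first sequence is Cauchy in the form norm and the second is bounded in it.
\<close>

lemma friedrichs_form_limit:
  assumes G: "positive_rel G" and ug: "(u, g) \<in> adjoint_rel G"
    and XY: "form_approx G X Y u" and XY': "form_approx G X' Y' u'"
  shows "(\<lambda>n. rip (Y n) (X' n)) \<longlonglongrightarrow> rip g u'"
proof -
  have mem: "(X n, Y n) \<in> G" "(X' n, Y' n) \<in> G" for n
    using XY XY' by (simp_all add: form_approx_def)
  have lim: "X \<longlonglongrightarrow> u" "X' \<longlonglongrightarrow> u'"
    using XY XY' by (simp_all add: form_approx_def)
  obtain K N' where K: "0 < K" "\<And>n. n \<ge> N' \<Longrightarrow> rip (Y' n) (X' n) \<le> K"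
    using form_approx_bounded[OF G XY'] by blast
  have "(\<lambda>n. rip (X n - u) (Y' n)) \<longlonglongrightarrow> 0"
  proof (rule LIMSEQ_I)
    fix e :: real
    assume e: "0 < e"
    define d where "d = (e / 2)\<^sup>2 / K"
    have d: "0 < d" using e K(1) by (simp add: d_def)
    obtain N where N: "\<And>m n. m \<ge> N \<Longrightarrow> n \<ge> N \<Longrightarrow> rip (Y m - Y n) (X m - X n) < d"
      using XY d unfolding form_approx_def by blast
    have "norm (rip (X n - u) (Y' n) - 0) < e" if n: "n \<ge> max N N'" for n
    proof -
      have step: "\<bar>rip (X n - X m) (Y' n)\<bar> \<le> e / 2" if m: "m \<ge> N" for m
      proof -
        have diff: "(X n - X m, Y n - Y m) \<in> G"
          by (intro subspace_pair_diff positive_relD(1)[OF G] mem)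
        have "rip (X n - X m) (Y' n) = rip (Y n - Y m) (X' n)"
          using positive_relD(2)[OF G diff mem(2)[of n]] by simp
        then have "(rip (X n - X m) (Y' n))\<^sup>2
            \<le> rip (Y n - Y m) (X n - X m) * rip (Y' n) (X' n)"
          using positive_rel_Cauchy_Schwarz[OF G diff mem(2)[of n]] by simp
        also have "\<dots> \<le> d * K"
          using N[of n m] K(2)[of n] n m d positive_relD(3)[OF G mem(2)[of n]]
          by (intro mult_mono) auto
        also have "\<dots> = (e / 2)\<^sup>2"
          using K(1) by (simp add: d_def)
        finally show ?thesis
          using e by (metis abs_le_square_iff abs_of_pos half_gt_zero)
      qed
      have "(\<lambda>m. \<bar>rip (X n - X m) (Y' n)\<bar>) \<longlonglongrightarrow> \<bar>rip (X n - u) (Y' n)\<bar>"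
        by (intro tendsto_rabs rip.tendsto tendsto_diff tendsto_const lim)
      then have "\<bar>rip (X n - u) (Y' n)\<bar> \<le> e / 2"
        using step by (intro LIMSEQ_le_const2) auto
      then show ?thesis using e by simp
    qed
    then show "\<exists>N. \<forall>n\<ge>N. norm (rip (X n - u) (Y' n) - 0) < e" by blast
  qed
  moreover have "(\<lambda>n. rip g (X' n)) \<longlonglongrightarrow> rip g u'"
    by (intro rip.tendsto tendsto_const lim)
  ultimately have "(\<lambda>n. rip (X n - u) (Y' n) + rip g (X' n)) \<longlonglongrightarrow> 0 + rip g u'"
    by (rule tendsto_add)
  moreover have "rip (X n - u) (Y' n) + rip g (X' n) = rip (Y n) (X' n)" for n
    using positive_relD(2)[OF G mem(1) mem(2), of n n] adjointD[OF ug mem(2)[of n]]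
    by (simp add: rip.diff_left rip_commute[of u] rip_commute[of g])
  ultimately show ?thesis by simp
qed

text \<open>
  The vector \<open>u\<close> is the limit of a minimizing sequence for the energy
  \<open>J(x, y) = (x + y, x) - 2 (f, x)\<close> on \<open>G\<close>. The parallelogram identity makes such a sequence Cauchy for
  the form and in norm; the Euler-Lagrange equation of the minimization says \<open>(x + y, u) = (f, x)\<close> for
  all \<open>(x, y)\<close> in \<open>G\<close>, that is, \<open>(u, f - u)\<close> lies in the adjoint.
\<close>

lemma friedrichs_surjective:
  assumes G: "positive_rel G"
  shows "\<exists>u. (u, f - u) \<in> friedrichs G"
proof -
  note sub = positive_relD(1)[OF G] and sym = positive_relD(2)[OF G] and pos = positive_relD(3)[OF G]
  define J where "J = (\<lambda>(x, y). rip (x + y) x - 2 * rip f x)"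
  define d where "d = Inf (J ` G)"
  have "- (norm f)\<^sup>2 \<le> J s" if "s \<in> G" for s
  proof -
    obtain x y where s: "s = (x, y)" by (cases s)
    have "0 \<le> rip (x - f) (x - f)" by (simp add: rip_self)
    moreover have "0 \<le> rip y x" using pos that s by blast
    ultimately show ?thesis
      by (simp add: J_def s rip.diff_left rip.diff_right rip.add_left rip.add_right
          rip_commute[of x f] flip: rip_self)
  qed
  then have bdd: "bdd_below (J ` G)" by (auto intro!: bdd_belowI)
  have ne: "J ` G \<noteq> {}"
    using subspace_0[OF sub] by blast
  have d_le: "d \<le> J s" if "s \<in> G" for s
    unfolding d_def using bdd that by (intro cInf_lower) auto
  have "\<exists>s\<in>G. J s < d + 1 / real (Suc n)" for n
  proof -
    have "Inf (J ` G) < d + 1 / real (Suc n)" by (simp add: d_def)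
    then show ?thesis
      using cInf_less_iff[OF ne bdd] by auto
  qed
  then obtain s where s: "\<And>n. s n \<in> G" "\<And>n. J (s n) < d + 1 / real (Suc n)" by metis
  define X where "X n = fst (s n)" for n
  define Y where "Y n = snd (s n)" for n
  have XY: "(X n, Y n) \<in> G" and J_XY: "J (X n, Y n) < d + 1 / real (Suc n)" for n
    using s[of n] by (simp_all add: X_def Y_def)
  \<comment> \<open>parallelogram identity: the midpoint of two almost minimizers has energy at least \<open>d\<close>\<close>
  have form_le: "rip (Y m - Y n) (X m - X n) + (norm (X m - X n))\<^sup>2 \<le> 4 / real (Suc N)"
    if "N \<le> m" "N \<le> n" for m n N
  proof -
    let ?x = "(1/2) *\<^sub>R (X m + X n)" and ?y = "(1/2) *\<^sub>R (Y m + Y n)"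
    have "(?x, ?y) \<in> G"
      by (intro subspace_pair_add subspace_pair_scale sub XY)
    then have "d \<le> J (?x, ?y)" by (rule d_le)
    moreover have "rip (Y m - Y n) (X m - X n) + (norm (X m - X n))\<^sup>2
        = 2 * J (X m, Y m) + 2 * J (X n, Y n) - 4 * J (?x, ?y)"
      by (simp add: J_def rip_self[symmetric] rip.diff_left rip.diff_right rip.add_left rip.add_right
          rip.scaleR_left rip.scaleR_right rip_commute[of "X n" "X m"] algebra_simps add_divide_distrib)
    moreover have "J (X m, Y m) < d + 1 / real (Suc N)" "J (X n, Y n) < d + 1 / real (Suc N)"
      using J_XY[of m] J_XY[of n] that
      by (smt (verit) frac_le of_nat_0_less_iff of_nat_le_iff Suc_le_mono zero_less_Suc)+
    ultimately show ?thesis by simp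
  qed
  have small: "\<exists>N. \<forall>m\<ge>N. \<forall>n\<ge>N. rip (Y m - Y n) (X m - X n) + (norm (X m - X n))\<^sup>2 < e"
    if e: "0 < e" for e
  proof -
    obtain N where "inverse (real (Suc N)) < e / 4"
      using reals_Archimedean[of "e / 4"] e by auto
    then have "4 / real (Suc N) < e" by (simp add: field_simps)
    then show ?thesis using form_le by (meson le_less_trans)
  qed
  have diff: "0 \<le> rip (Y m - Y n) (X m - X n)" for m n
    by (intro pos subspace_pair_diff sub XY)
  have "Cauchy X"
  proof (rule CauchyI)
    fix e :: real
    assume e: "0 < e"
    then obtain N where N: "\<And>m n. m \<ge> N \<Longrightarrow> n \<ge> N \<Longrightarrow>
        rip (Y m - Y n) (X m - X n) + (norm (X m - X n))\<^sup>2 < e\<^sup>2"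
      using small[of "e\<^sup>2"] by auto
    have "norm (X m - X n) < e" if "m \<ge> N" "n \<ge> N" for m n
    proof (rule power_less_imp_less_base)
      show "(norm (X m - X n))\<^sup>2 < e\<^sup>2"
        using N[OF that] diff[of m n] by linarith
    qed (use e in simp)
    then show "\<exists>M. \<forall>m\<ge>M. \<forall>n\<ge>M. norm (X m - X n) < e" by blast
  qed
  then obtain u where u: "X \<longlonglongrightarrow> u"
    using Cauchy_convergent convergent_def by blast
  have approx: "form_approx G X Y u"
    unfolding form_approx_def
  proof (intro conjI allI impI XY u)
    fix e :: real
    assume "0 < e"
    then obtain N where "\<forall>m\<ge>N. \<forall>n\<ge>N. rip (Y m - Y n) (X m - X n) + (norm (X m - X n))\<^sup>2 < e"
      using small by blast
    then show "\<exists>N. \<forall>m\<ge>N. \<forall>n\<ge>N. rip (Y m - Y n) (X m - X n) < e"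
      by (smt (verit) zero_le_power2)
  qed
  have "(u, f - u) \<in> adjoint_rel G"
  proof (rule adjointI)
    fix x y
    assume xy: "(x, y) \<in> G"
    define a where "a = rip (x + y) x"
    have a: "0 \<le> a"
      using pos[OF xy] by (simp add: a_def rip.add_left rip_self)
    \<comment> \<open>approximate Euler-Lagrange equation, from the energy along the line through the \<open>n\<close>-th pair\<close>
    have bound: "(rip (X n) (x + y) - rip f x)\<^sup>2 \<le> a / real (Suc n)" for n
    proof -
      have "(rip (X n) (x + y) - rip f x)\<^sup>2 \<le> (J (X n, Y n) - d) * a"
      proof (rule discriminant_le[OF _ a])
        fix r
        have "(X n + r *\<^sub>R x, Y n + r *\<^sub>R y) \<in> G"
          by (intro subspace_pair_add subspace_pair_scale sub XY xy)
        then have "d \<le> J (X n + r *\<^sub>R x, Y n + r *\<^sub>R y)" by (rule d_le)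
        also have "\<dots> = J (X n, Y n) + 2 * r * (rip (X n) (x + y) - rip f x) + r\<^sup>2 * a"
          using sym[OF XY[of n] xy]
          by (simp add: J_def a_def rip_add_left rip_add_right rip_scaleR_left rip_scaleR_right
              rip_commute[of x "X n"] rip_commute[of y "X n"] power2_eq_square algebra_simps)
        finally show "0 \<le> J (X n, Y n) - d + 2 * r * (rip (X n) (x + y) - rip f x) + r\<^sup>2 * a"
          by simp
      qed
      also have "\<dots> \<le> 1 / real (Suc n) * a"
        using J_XY[of n] by (intro mult_right_mono a) simp
      finally show ?thesis by simp
    qed
    have "(\<lambda>n. (rip (X n) (x + y) - rip f x)\<^sup>2) \<longlonglongrightarrow> (rip u (x + y) - rip f x)\<^sup>2"
      by (intro tendsto_intros rip.tendsto u)
    moreover have "(\<lambda>n. a / real (Suc n)) \<longlonglongrightarrow> 0"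
      using tendsto_mult_right_zero[OF LIMSEQ_inverse_real_of_nat, of a]
      by (simp add: divide_inverse)
    ultimately have "(rip u (x + y) - rip f x)\<^sup>2 \<le> 0"
      using bound by (intro LIMSEQ_le[of _ _ "\<lambda>n. a / real (Suc n)"]) auto
    then have "rip u (x + y) = rip f x" by simp
    then show "rip y u = rip x (f - u)"
      by (simp add: rip.add_right rip.diff_right rip_commute)
  qed
  then show ?thesis
    using approx by (auto simp: friedrichs_def)
qed

lemma friedrichs_extends:
  assumes "positive_rel G"
  shows "G \<subseteq> friedrichs G"
proof (rule subrelI)
  fix x y
  assume xy: "(x, y) \<in> G"
  then have "form_approx G (\<lambda>_. x) (\<lambda>_. y) x"
    by (auto simp: form_approx_def rip.zero_left)
  then show "(x, y) \<in> friedrichs G"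
    using assms xy by (auto simp: friedrichs_def positive_rel_def)
qed

lemma adjoint_invariant:
  fixes M N :: "'a \<Rightarrow>\<^sub>L 'a"
  assumes "\<And>x y. (x, y) \<in> G \<Longrightarrow> (N x, N y) \<in> G"
    and "\<And>x y. rip (N x) y = rip x (M y)"
    and "(u, g) \<in> adjoint_rel G"
  shows "(M u, M g) \<in> adjoint_rel G"
  using assms by (intro adjointI) (metis adjointD)

text \<open>
  \<open>M\<close> stands for multiplication by a scalar \<open>c\<close> and \<open>N\<close> for multiplication by its conjugate, so that
  \<open>K = |c|\<^sup>2\<close> is the factor by which \<open>M\<close> multiplies the form. Real \<open>c\<close> is used for linearity over the
  reals, general \<open>c\<close> for linearity over the scalar field.
\<close>

lemma friedrichs_invariant:
  fixes M N :: "'a \<Rightarrow>\<^sub>L 'a"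
  assumes G: "positive_rel G"
    and M: "\<And>x y. (x, y) \<in> G \<Longrightarrow> (M x, M y) \<in> G"
    and N: "\<And>x y. (x, y) \<in> G \<Longrightarrow> (N x, N y) \<in> G"
    and adj: "\<And>x y. rip (N x) y = rip x (M y)"
    and scalar: "\<And>x. N (M x) = K *\<^sub>R x"
    and ug: "(u, g) \<in> friedrichs G"
  shows "(M u, M g) \<in> friedrichs G"
proof -
  obtain X Y where XY: "form_approx G X Y u" and mem: "(u, g) \<in> adjoint_rel G"
    using ug by (auto simp: friedrichs_def)
  have "form_approx G (\<lambda>n. M (X n)) (\<lambda>n. M (Y n)) (M u)"
    unfolding form_approx_def
  proof (intro conjI allI impI)
    show "(M (X n), M (Y n)) \<in> G" for n
      using XY M by (simp add: form_approx_def)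
    show "(\<lambda>n. M (X n)) \<longlonglongrightarrow> M u"
      using XY by (intro blinfun.tendsto tendsto_const) (simp add: form_approx_def)
    fix e :: real
    assume "0 < e"
    then have d: "0 < e / (\<bar>K\<bar> + 1)" by simp
    then obtain L where L: "\<And>m n. m \<ge> L \<Longrightarrow> n \<ge> L \<Longrightarrow> rip (Y m - Y n) (X m - X n) < e / (\<bar>K\<bar> + 1)"
      using XY unfolding form_approx_def by meson
    have "rip (M (Y m) - M (Y n)) (M (X m) - M (X n)) < e" if "m \<ge> L" "n \<ge> L" for m n
    proof -
      let ?t = "rip (Y m - Y n) (X m - X n)"
      have t: "0 \<le> ?t"
        using XY by (intro positive_relD(3)[OF G] subspace_pair_diff positive_relD(1)[OF G])
          (simp_all add: form_approx_def)
      have "rip (M (Y m) - M (Y n)) (M (X m) - M (X n)) = K * ?t"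
        by (metis adj blinfun.diff_right rip_commute rip_scaleR_right scalar)
      also have "\<dots> \<le> (\<bar>K\<bar> + 1) * ?t"
        using t by (intro mult_right_mono) auto
      also have "\<dots> < e"
        using L[OF that] by (simp add: field_simps)
      finally show ?thesis .
    qed
    then show "\<exists>L. \<forall>m\<ge>L. \<forall>n\<ge>L. rip (M (Y m) - M (Y n)) (M (X m) - M (X n)) < e" by blast
  qed
  moreover have "(M u, M g) \<in> adjoint_rel G"
    using adjoint_invariant[OF N adj mem] .
  ultimately show ?thesis by (auto simp: friedrichs_def)
qed

lemma subspace_friedrichs:
  assumes G: "positive_rel G"
  shows "subspace (friedrichs G)"
proof -
  note sub = positive_relD(1)[OF G]
  have add: "(u + u', g + g') \<in> friedrichs G"
    if mem: "(u, g) \<in> friedrichs G" "(u', g') \<in> friedrichs G" for u g u' g'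
  proof -
    obtain X Y X' Y' where XY: "form_approx G X Y u" "form_approx G X' Y' u'"
      using mem by (auto simp: friedrichs_def)
    have "form_approx G (\<lambda>n. X n + X' n) (\<lambda>n. Y n + Y' n) (u + u')"
      unfolding form_approx_def
    proof (intro conjI allI impI)
      show "(X n + X' n, Y n + Y' n) \<in> G" for n
        using XY by (intro subspace_pair_add sub) (simp_all add: form_approx_def)
      show "(\<lambda>n. X n + X' n) \<longlonglongrightarrow> u + u'"
        using XY by (intro tendsto_add) (simp_all add: form_approx_def)
      fix e :: real
      assume "0 < e"
      then have "0 < e / 4" by simp
      then obtain N N' where N: "\<And>m n. m \<ge> N \<Longrightarrow> n \<ge> N \<Longrightarrow> rip (Y m - Y n) (X m - X n) < e / 4"
        "\<And>m n. m \<ge> N' \<Longrightarrow> n \<ge> N' \<Longrightarrow> rip (Y' m - Y' n) (X' m - X' n) < e / 4"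
        using XY unfolding form_approx_def by meson
      have "rip (Y m + Y' m - (Y n + Y' n)) (X m + X' m - (X n + X' n)) < e"
        if "m \<ge> max N N'" "n \<ge> max N N'" for m n
      proof -
        let ?x = "X m - X n" and ?y = "Y m - Y n" and ?x' = "X' m - X' n" and ?y' = "Y' m - Y' n"
        have "(?x - ?x', ?y - ?y') \<in> G"
          using XY by (intro subspace_pair_diff sub) (simp_all add: form_approx_def)
        then have "0 \<le> rip (?y - ?y') (?x - ?x')"
          by (rule positive_relD(3)[OF G])
        then have "rip (?y + ?y') (?x + ?x') \<le> 2 * rip ?y ?x + 2 * rip ?y' ?x'"
          by (simp add: rip.diff_left[of ?y] rip.diff_right[of _ ?x] rip.add_left[of ?y]
              rip.add_right[of _ ?x])
        also have "\<dots> < e"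
          using N(1)[of m n] N(2)[of m n] that by simp
        finally show ?thesis by (simp add: algebra_simps)
      qed
      then show "\<exists>M. \<forall>m\<ge>M. \<forall>n\<ge>M.
          rip (Y m + Y' m - (Y n + Y' n)) (X m + X' m - (X n + X' n)) < e" by blast
    qed
    moreover have "(u + u', g + g') \<in> adjoint_rel G"
      using mem by (intro subspace_pair_add subspace_adjoint) (auto simp: friedrichs_def)
    ultimately show ?thesis by (auto simp: friedrichs_def)
  qed
  have scale: "(r *\<^sub>R u, r *\<^sub>R g) \<in> friedrichs G" if "(u, g) \<in> friedrichs G" for r u g
    using friedrichs_invariant[OF G, where M = "r *\<^sub>R id_blinfun" and N = "r *\<^sub>R id_blinfun"
        and K = "r * r"] that
    by (simp add: blinfun.bilinear_simps rip.scaleR_left rip.scaleR_right subspace_pair_scale[OF sub])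
  have "(0, 0) \<in> friedrichs G"
    using friedrichs_extends[OF G] subspace_0[OF sub] by (auto simp: zero_prod_def)
  then show ?thesis
    using add scale by (auto simp: subspace_def zero_prod_def)
qed

text \<open>
  Symmetry and positivity are inherited through form limits. If \<open>(u, g)\<close> is in the adjoint of \<open>friedrichs G\<close>, let \<open>(u', g')\<close>
  in \<open>friedrichs G\<close> solve \<open>u' + g' = u + g\<close>: then \<open>w = u - u'\<close> is orthogonal to all sums \<open>x + y\<close> of pairs
  of \<open>friedrichs G\<close>, and these sums exhaust the space, so \<open>w = 0\<close>.
\<close>

theorem positive_sa_rel_friedrichs:
  assumes G: "positive_rel G"
  shows "positive_sa_rel (friedrichs G)"
proof -
  let ?F = "friedrichs G"
  have sub: "subspace ?F" by (rule subspace_friedrichs[OF G])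
  have sym: "rip g u' = rip u g'" if ug: "(u, g) \<in> ?F" "(u', g') \<in> ?F" for u g u' g'
  proof -
    obtain X Y X' Y' where XY: "form_approx G X Y u" "form_approx G X' Y' u'"
      using ug by (auto simp: friedrichs_def)
    have adj: "(u, g) \<in> adjoint_rel G" "(u', g') \<in> adjoint_rel G"
      using ug by (auto simp: friedrichs_def)
    have eq: "rip (Y n) (X' n) = rip (Y' n) (X n)" for n
      using XY positive_relD(2)[OF G, of "X n" "Y n" "X' n" "Y' n"]
      by (simp add: form_approx_def rip_commute)
    have "rip g u' = rip g' u"
      using friedrichs_form_limit[OF G adj(1) XY] friedrichs_form_limit[OF G adj(2) XY(2,1)]
      unfolding eq by (rule LIMSEQ_unique)
    then show ?thesis by (simp add: rip_commute)
  qed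
  have pos: "0 \<le> rip g u" if ug: "(u, g) \<in> ?F" for u g
  proof -
    obtain X Y where XY: "form_approx G X Y u" and adj: "(u, g) \<in> adjoint_rel G"
      using ug by (auto simp: friedrichs_def)
    have "0 \<le> rip (Y n) (X n)" for n
      using XY positive_relD(3)[OF G] by (simp add: form_approx_def)
    then show ?thesis
      using friedrichs_form_limit[OF G adj XY XY] by (intro LIMSEQ_le_const) auto
  qed
  have F: "positive_rel ?F"
    using sub sym pos by (auto simp: positive_rel_def intro!: adjointI)
  have "adjoint_rel ?F \<subseteq> ?F"
  proof (rule subrelI)
    fix u g
    assume ug: "(u, g) \<in> adjoint_rel ?F"
    obtain u' where u': "(u', u + g - u') \<in> ?F"
      using friedrichs_surjective[OF G] by blast
    define w where "w = u - u'"
    obtain x where x: "(x, w - x) \<in> ?F"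
      using friedrichs_surjective[OF G] by blast
    have "(u', u + g - u') \<in> adjoint_rel ?F"
      using u' F by (auto simp: positive_rel_def)
    then have "(u - u', g - (u + g - u')) \<in> adjoint_rel ?F"
      by (intro subspace_pair_diff subspace_adjoint ug)
    moreover have "g - (u + g - u') = - w" by (simp add: w_def)
    ultimately have "(w, - w) \<in> adjoint_rel ?F" by (simp add: w_def)
    from adjointD[OF this x] have "rip w w = 0"
      by (simp add: rip.diff_left rip.minus_right)
    then have "u = u'" by (simp add: rip_self w_def)
    then show "(u, g) \<in> ?F" using u' by simp
  qed
  then show ?thesis
    using F by (auto simp: positive_sa_rel_def positive_rel_def)
qed


section \<open>Square roots of positive self-adjoint relations\<close>

lemma positive_sa_relD:
  assumes "positive_sa_rel G"
  shows "positive_rel G" "subspace G"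
    and "(x, y) \<in> G \<Longrightarrow> (x', y') \<in> G \<Longrightarrow> rip y x' = rip x y'"
    and "(\<And>x y. (x, y) \<in> G \<Longrightarrow> rip y u = rip x v) \<Longrightarrow> (u, v) \<in> G"
  using assms positive_relD adjointI unfolding positive_sa_rel_def by blast+

lemma positive_sa_rel_closed:
  assumes "positive_sa_rel G" "\<And>n. (X n, Y n) \<in> G" and "X \<longlonglongrightarrow> u" "Y \<longlonglongrightarrow> v"
  shows "(u, v) \<in> G"
  using adjoint_closed[of X Y G u v] assms by (auto simp: positive_sa_rel_def)

lemma positive_rel_norm_le:
  assumes "positive_rel G" "(x, y) \<in> G"
  shows "norm x \<le> norm (x + y)" "norm y \<le> norm (x + y)"
proof -
  have "(norm (x + y))\<^sup>2 = (norm x)\<^sup>2 + 2 * rip y x + (norm y)\<^sup>2"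
    by (simp add: rip_self[symmetric] rip_add_left rip_add_right rip_commute[of x y])
  then have "(norm x)\<^sup>2 \<le> (norm (x + y))\<^sup>2" "(norm y)\<^sup>2 \<le> (norm (x + y))\<^sup>2"
    using positive_relD(3)[OF assms] by simp_all
  then show "norm x \<le> norm (x + y)" "norm y \<le> norm (x + y)"
    using power2_le_imp_le by fastforce+
qed

text \<open>
  The operator \<open>C\<close> is \<open>(1 + G)\<^sup>-\<^sup>1\<close>. That \<open>1 + G\<close> is onto follows from the energy minimization applied to \<open>G\<close>
  itself, as Friedrichs' extension of \<open>G\<close> lies in the adjoint \<open>G\<close>; uniqueness of the solution and the
  norm bounds follow from \<open>\<parallel>x + y\<parallel>\<^sup>2 = \<parallel>x\<parallel>\<^sup>2 + 2 (y, x) + \<parallel>y\<parallel>\<^sup>2\<close>.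
\<close>

lemma resolvent:
  assumes G: "positive_sa_rel G"
  obtains C where "unit_positive C" and "unit_positive (id_blinfun - C)"
    and "G = range (\<lambda>z. (C z, z - C z))"
    and "\<And>M. (\<And>x y. (x, y) \<in> G \<Longrightarrow> (blinfun_apply M x, M y) \<in> G) \<Longrightarrow> commutes M C"
proof -
  note pos = positive_sa_relD(1)[OF G] and sub = positive_sa_relD(2)[OF G]
    and sym = positive_sa_relD(3)[OF G]
  have "friedrichs G \<subseteq> G"
    using G by (auto simp: friedrichs_def positive_sa_rel_def)
  then have "\<exists>u. (u, z - u) \<in> G" for z
    using friedrichs_surjective[OF pos] by blast
  then obtain c where c: "\<And>z. (c z, z - c z) \<in> G" by metis
  have c_eq: "c (u + v) = u" if "(u, v) \<in> G" for u v
  proof -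
    have "norm (c (u + v) - u) \<le> norm (c (u + v) - u + (u + v - c (u + v) - v))"
      by (rule positive_rel_norm_le[OF pos]) (intro subspace_pair_diff sub c that)
    then show ?thesis by simp
  qed
  have bl: "bounded_linear c"
  proof (rule bounded_linear_intro[where K = 1])
    show "c (x + y) = c x + c y" for x y
      using c_eq[OF subspace_pair_add[OF sub c[of x] c[of y]]] by simp
    show "c (r *\<^sub>R x) = r *\<^sub>R c x" for r x
      using c_eq[OF subspace_pair_scale[OF sub c[of x], of r]]
      by (simp flip: scaleR_add_right)
    show "norm (c x) \<le> norm x * 1" for x
      using positive_rel_norm_le(1)[OF pos c[of x]] by simp
  qed
  define C where "C = Blinfun c"
  have C: "blinfun_apply C = c"
    using bl by (simp add: C_def bounded_linear_Blinfun_apply)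
  show ?thesis
  proof (rule that[of C])
    have sa: "selfadj C"
      unfolding selfadj_def
    proof (intro allI)
      fix x y
      show "rip (C x) y = rip x (C y)"
        using sym[OF c[of x] c[of y]] by (simp add: C rip.diff_left rip.diff_right)
    qed
    have "norm (id_blinfun - C) \<le> 1"
      by (rule norm_blinfun_bound)
        (use positive_rel_norm_le(2)[OF pos c] in \<open>simp_all add: blinfun.diff_left C\<close>)
    then show "unit_positive C"
      using sa by (simp add: unit_positive_def)
    have "norm C \<le> 1"
      by (rule norm_blinfun_bound) (use positive_rel_norm_le(1)[OF pos c] in \<open>simp_all add: C\<close>)
    then show "unit_positive (id_blinfun - C)"
      using sa by (simp add: unit_positive_def selfadj_def blinfun.diff_left rip.diff_left rip.diff_right)
    show "G = range (\<lambda>z. (C z, z - C z))"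
    proof (intro equalityI subrelI)
      fix u v
      assume "(u, v) \<in> G"
      then show "(u, v) \<in> range (\<lambda>z. (C z, z - C z))"
        using c_eq by (intro range_eqI[of _ _ "u + v"]) (simp add: C)
    qed (use c in \<open>auto simp: C\<close>)
    show "commutes M C" if M: "\<And>x y. (x, y) \<in> G \<Longrightarrow> (M x, M y) \<in> G" for M :: "'a \<Rightarrow>\<^sub>L 'a"
    proof
      fix z
      have "c (M (c z) + M (z - c z)) = M (c z)"
        by (rule c_eq[OF M[OF c]])
      then show "M (C z) = C (M z)"
        by (simp add: C flip: blinfun.add_right)
    qed
  qed
qed

text \<open>
  The identity \<open>P\<^sup>2 + Q\<^sup>2 = 1\<close> makes \<open>x \<mapsto> (Px, Qx)\<close> an isometry, with \<open>(u, v) \<mapsto> Pu + Qv\<close> as its adjoint.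
\<close>

definition cos_sin_pair :: "('a \<Rightarrow>\<^sub>L 'a) \<Rightarrow> ('a \<Rightarrow>\<^sub>L 'a) \<Rightarrow> bool" where
  "cos_sin_pair P Q \<longleftrightarrow> unit_positive P \<and> unit_positive Q \<and> commutes P Q \<and>
     (\<forall>x. P (P x) + Q (Q x) = x)"

lemma cos_sin_pair_solve:
  assumes PQ: "cos_sin_pair P Q" and eq: "Q u = P v"
  shows "P (P u + Q v) = u" "Q (P u + Q v) = v"
proof -
  have 1: "P (P x) + Q (Q x) = x" "P (Q x) = Q (P x)" for x
    using PQ by (simp_all add: cos_sin_pair_def)
  show "P (P u + Q v) = u"
    using 1(1)[of u] 1(2)[of v] eq by (simp add: blinfun.add_right)
  show "Q (P u + Q v) = v"
    using 1(1)[of v] 1(2)[of u] eq by (simp add: blinfun.add_right flip: 1(2))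
qed

text \<open>
  The pairs \<open>(Px, Qx)\<close> are the solutions \<open>(u, v)\<close> of \<open>Qu = Pv\<close>, with \<open>x = Pu + Qv\<close>. Membership in the
  adjoint is the same equation, since \<open>P\<close> and \<open>Q\<close> are self-adjoint; hence self-adjointness. A
  composable couple of pairs gives \<open>Qx = Py\<close>, and solving this again for \<open>z = Px + Qy\<close> yields \<open>R\<^sup>2\<close>.
\<close>

lemma cos_sin_pair_relation:
  assumes PQ: "cos_sin_pair P Q"
  defines "R \<equiv> range (\<lambda>x. (P x, Q x))"
  shows "(u, v) \<in> R \<longleftrightarrow> Q u = P v"
    and "positive_sa_rel R"
    and "R O R = range (\<lambda>z. (P (P z), Q (Q z)))"
proof -
  have comm: "P (Q x) = Q (P x)" for x
    using PQ by (simp add: cos_sin_pair_def)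
  have sa: "rip (P x) y = rip x (P y)" "rip (Q x) y = rip x (Q y)" for x y
    using PQ by (simp_all add: cos_sin_pair_def unit_positive_def selfadjD)
  show mem: "(u, v) \<in> R \<longleftrightarrow> Q u = P v" for u v
  proof
    assume "Q u = P v"
    then show "(u, v) \<in> R"
      unfolding R_def using cos_sin_pair_solve[OF PQ, of u v]
      by (intro range_eqI[of _ _ "P u + Q v"]) simp
  qed (auto simp: R_def comm)
  have adj: "adjoint_rel R = R"
  proof (intro equalityI subrelI)
    fix u v
    assume uv: "(u, v) \<in> adjoint_rel R"
    have "rip x (Q u - P v) = 0" for x
      using adjointD[OF uv, of "P x" "Q x"] by (simp add: R_def sa rip.diff_right)
    from this[of "Q u - P v"] show "(u, v) \<in> R"
      by (simp add: mem rip_self)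
  next
    fix u v
    assume "(u, v) \<in> R"
    then show "(u, v) \<in> adjoint_rel R"
      by (auto simp: mem R_def sa comm intro!: adjointI)
  qed
  have "subspace R"
    using subspace_adjoint[of R] by (simp add: adj)
  moreover have "0 \<le> rip y x" if xy: "(x, y) \<in> R" for x y
  proof -
    obtain Z where Z: "selfadj Z" "\<And>x. Z (Z x) = P (Q x)"
      using commuting_product_root[of P Q] PQ by (auto simp: cos_sin_pair_def)
    obtain z where "x = P z" "y = Q z"
      using xy by (auto simp: R_def)
    then have "rip y x = rip ((P o\<^sub>L Q) z) z"
      by (simp add: sa rip_commute)
    then show ?thesis
      using selfadj_square_nonneg(1)[of Z "P o\<^sub>L Q" z] Z by simp
  qed
  ultimately show "positive_sa_rel R"
    by (auto simp: positive_sa_rel_def positive_rel_def adj)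
  show "R O R = range (\<lambda>z. (P (P z), Q (Q z)))"
  proof (intro equalityI subrelI)
    fix u w
    assume "(u, w) \<in> R O R"
    then obtain x y where xy: "u = P x" "Q x = P y" "w = Q y"
      by (auto simp: R_def)
    then show "(u, w) \<in> range (\<lambda>z. (P (P z), Q (Q z)))"
      using cos_sin_pair_solve[OF PQ xy(2)]
      by (intro range_eqI[of _ _ "P x + Q y"]) simp
  next
    fix u w
    assume "(u, w) \<in> range (\<lambda>z. (P (P z), Q (Q z)))"
    then obtain z where z: "u = P (P z)" "w = Q (Q z)"
      by auto
    show "(u, w) \<in> R O R"
      by (rule relcompI[of _ "P (Q z)"]) (simp_all add: mem z comm)
  qed
qed

text \<open>
  Existence comes from the commuting roots of \<open>A\<close> and \<open>1 - A\<close>, where \<open>A\<close> is the resolvent of \<open>S\<close>. For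
  uniqueness let \<open>C\<close> be the resolvent of another root and \<open>D = 1 - C\<close>. Its square contains the pairs
  \<open>(C\<^sup>2z, D\<^sup>2z)\<close>, so \<open>Q\<^sup>2C\<^sup>2 = P\<^sup>2D\<^sup>2\<close>. The operators commute, and uniqueness of bounded positive roots gives
  \<open>QC = PD\<close>, that is, the pairs \<open>(Cz, Dz)\<close> lie in \<open>R\<close>. Taking adjoints gives the reverse inclusion. The
  last conclusion will turn linearity over the scalar field of an operator into that of its root.
\<close>

theorem positive_sa_rel_root:
  assumes S: "positive_sa_rel S"
  obtains R where "positive_sa_rel R" and "R O R = S"
    and "\<And>R'. positive_sa_rel R' \<Longrightarrow> R' O R' = S \<Longrightarrow> R' = R"
    and "\<And>M x y. (\<And>x y. (x, y) \<in> S \<Longrightarrow> (blinfun_apply M x, M y) \<in> S) \<Longrightarrow> (x, y) \<in> R \<Longrightarrow> (M x, M y) \<in> R"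
proof -
  obtain A where A: "unit_positive A" "unit_positive (id_blinfun - A)"
    and S_eq: "S = range (\<lambda>z. (A z, z - A z))"
    and A_comm: "\<And>M. (\<And>x y. (x, y) \<in> S \<Longrightarrow> (blinfun_apply M x, M y) \<in> S) \<Longrightarrow> commutes M A"
    using resolvent[OF S] by blast
  obtain P where P: "unit_positive P" "\<And>x. P (P x) = A x"
    and P_comm: "\<And>M. commutes M A \<Longrightarrow> commutes M P"
    using unit_positive_root[OF A(1)] by blast
  obtain Q where Q: "unit_positive Q" "\<And>x. Q (Q x) = (id_blinfun - A) x"
    and Q_comm': "\<And>M. commutes M (id_blinfun - A) \<Longrightarrow> commutes M Q"
    using unit_positive_root[OF A(2)] by blast
  have Q_comm: "commutes M Q" if "commutes M A" for M
    by (rule Q_comm') (simp add: that blinfun.diff_left blinfun.diff_right)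
  have "commutes A P" by (rule P_comm) simp
  then have "commutes P Q" by (intro Q_comm) simp
  then have PQ: "cos_sin_pair P Q"
    using P Q by (simp add: cos_sin_pair_def blinfun.diff_left)
  define R where "R = range (\<lambda>x. (P x, Q x))"
  note R = cos_sin_pair_relation[OF PQ, folded R_def]
  have invariant: "(M x, M y) \<in> R"
    if M: "\<And>x y. (x, y) \<in> S \<Longrightarrow> (M x, M y) \<in> S" and xy: "(x, y) \<in> R" for M :: "'a \<Rightarrow>\<^sub>L 'a" and x y
  proof -
    have "commutes M A" by (rule A_comm) (rule M)
    then have "commutes M P" "commutes M Q"
      by (rule P_comm, rule Q_comm)
    moreover have "M (Q x) = M (P y)"
      using xy by (simp add: R(1))
    ultimately show ?thesis by (simp add: R(1))
  qed
  have unique: "R' = R" if R': "positive_sa_rel R'" and sq: "R' O R' = S" for R'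
  proof -
    obtain C where C: "unit_positive C" "unit_positive (id_blinfun - C)"
      and R'_eq: "R' = range (\<lambda>z. (C z, z - C z))"
      by (rule resolvent[OF R'], rule that)
    define D where "D = id_blinfun - C"
    have D: "D x = x - C x" for x by (simp add: D_def blinfun.diff_left)
    have "(C x, C y) \<in> R'" if "(x, y) \<in> R'" for x y
      using that by (auto simp: R'_eq blinfun.diff_right)
    then have "(C x, C y) \<in> S" if "(x, y) \<in> S" for x y
      using that unfolding sq[symmetric] by blast
    then have "commutes C A" by (rule A_comm)
    then have comm: "commutes C P" "commutes C Q"
      using P_comm Q_comm by blast+
    then have comm': "commutes D P" "commutes D Q" "commutes C D"
      by (simp_all add: D blinfun.diff_right)
    have CD: "Q (Q (C (C z))) = P (P (D (D z)))" for z
    proof -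
      have "(C (C z), D (C z)) \<in> R'" "(C (D z), D (D z)) \<in> R'"
        by (auto simp: R'_eq D)
      then have "(C (C z), D (D z)) \<in> S"
        using comm'(3) by (auto simp flip: sq)
      then obtain w where "C (C z) = A w" "D (D z) = w - A w"
        by (auto simp: S_eq)
      then show ?thesis
        using \<open>commutes P Q\<close> P(2) Q(2) by (simp add: blinfun.diff_left blinfun.diff_right)
    qed
    obtain Z where Z: "selfadj Z" "\<And>x. Z (Z x) = Q (C x)"
      using commuting_product_root[OF Q(1) C(1)] comm by metis
    obtain W where W: "selfadj W" "\<And>x. W (W x) = P (D x)"
      using commuting_product_root[OF P(1) C(2)] comm' by (metis D_def)
    have root: "(Q o\<^sub>L C) z = (P o\<^sub>L D) z" for z
    proof (rule positive_root_unique[OF Z(1) _ W(1)])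
      show "commutes (Q o\<^sub>L C) (P o\<^sub>L D)"
        using comm comm' \<open>commutes P Q\<close> by simp
      show "(Q o\<^sub>L C) ((Q o\<^sub>L C) x) = (P o\<^sub>L D) ((P o\<^sub>L D) x)" for x
        using CD comm comm' by simp
    qed (simp_all add: Z W)
    have "(u, v) \<in> R" if "(u, v) \<in> R'" for u v
      using that root by (auto simp: R'_eq R(1) D)
    then have sub: "R' \<subseteq> R" by auto
    then have "R \<subseteq> R'"
      using adjoint_antimono[OF sub] R(2) R' by (simp add: positive_sa_rel_def)
    with sub show ?thesis by simp
  qed
  show ?thesis
  proof (rule that[of R])
    show "R O R = S"
      unfolding R(3) S_eq by (simp add: P Q blinfun.diff_left)
  qed (use R(2) unique invariant in blast)+
qed


section \<open>Maximality of Friedrichs' extension\<close>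

text \<open>
  The differences of two values at the same point are orthogonal to the domain.
\<close>

lemma dense_single_valued:
  assumes L: "positive_sa_rel L" and dense: "closure (Domain L) = UNIV"
    and "(x, y) \<in> L" "(x, y') \<in> L"
  shows "y = y'"
proof -
  have "(0, y - y') \<in> L"
    using subspace_pair_diff[OF positive_sa_relD(2)[OF L] assms(3,4)] by simp
  then have "rip a (y - y') = 0" if "a \<in> Domain L" for a
    using that positive_sa_relD(3)[OF L] by (metis DomainE rip.zero_right)
  then have "y - y' = 0"
    by (rule orthogonal_to_dense_eq_0[OF dense])
  then show ?thesis by simp
qed

lemma root_form:
  assumes "positive_sa_rel L" and "(x, z) \<in> L" "(z, y) \<in> L"
  shows "rip y x = (norm z)\<^sup>2"
  using positive_sa_relD(3)[OF assms] by (simp add: rip_self rip_commute)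

text \<open>
  Write \<open>(h, k) = (Cz, z - Cz)\<close> with the resolvent \<open>C\<close> of \<open>K\<close>. If \<open>z\<close> is replaced by \<open>s\<close> in the dense
  domain of \<open>K\<close>, then \<open>Cs\<close> lies in the domain of \<open>K\<^sup>2\<close>, because \<open>C\<close> maps the domain of \<open>K\<close> into itself
  and hence \<open>s - Cs\<close> stays in that domain. Boundedness of \<open>C\<close> gives convergence.
\<close>

lemma root_core:
  assumes K: "positive_sa_rel K" and dense: "closure (Domain K) = UNIV" and hk: "(h, k) \<in> K"
  obtains U V where "\<And>n. (U n, V n) \<in> K" "\<And>n. U n \<in> Domain (K O K)"
    and "U \<longlonglongrightarrow> h" "V \<longlonglongrightarrow> k"
proof -
  obtain C :: "'a \<Rightarrow>\<^sub>L 'a" where K_eq: "K = range (\<lambda>z. (C z, z - C z))"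
    by (rule resolvent[OF K], rule that)
  obtain z where z: "h = C z" "k = z - C z"
    using hk by (auto simp: K_eq)
  obtain s where s: "\<And>n. s n \<in> Domain K" "s \<longlonglongrightarrow> z"
    using dense closure_sequential[of z "Domain K"] by blast
  show ?thesis
  proof (rule that[of "\<lambda>n. C (s n)" "\<lambda>n. s n - C (s n)"])
    show graph: "(C (s n), s n - C (s n)) \<in> K" for n
      by (auto simp: K_eq)
    show "C (s n) \<in> Domain (K O K)" for n
    proof -
      obtain t where t: "(s n, t) \<in> K" using s(1) by blast
      from t obtain w where w: "s n = C w" by (auto simp: K_eq)
      have "s n - C (s n) = C (w - C w)"
        by (simp add: w blinfun.diff_right)
      then have "s n - C (s n) \<in> Domain K"
        by (auto simp: K_eq)
      then show ?thesis using graph[of n] by blast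
    qed
    show "(\<lambda>n. C (s n)) \<longlonglongrightarrow> h"
      unfolding z by (intro blinfun.tendsto tendsto_const s)
    then show "(\<lambda>n. s n - C (s n)) \<longlonglongrightarrow> k"
      unfolding z by (intro tendsto_diff s)
  qed
qed

text \<open>
  On \<open>G\<close> the form is the squared norm of the values of \<open>L\<close>. Along an approximating sequence these
  values are thus Cauchy, and closedness of \<open>L\<close> gives a value at \<open>u\<close> whose squared norm is the limit of
  the form.
\<close>

lemma friedrichs_form_eq:
  assumes G: "positive_rel G" and L: "positive_sa_rel L" and sub: "G \<subseteq> L O L"
    and ug: "(u, g) \<in> friedrichs G"
  obtains l where "(u, l) \<in> L" "(norm l)\<^sup>2 = rip g u"
proof -
  obtain X Y where XY: "form_approx G X Y u" and adj: "(u, g) \<in> adjoint_rel G"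
    using ug by (auto simp: friedrichs_def)
  have "\<exists>z. (X n, z) \<in> L \<and> (z, Y n) \<in> L" for n
    using XY sub by (auto simp: form_approx_def)
  then obtain Z where Z: "\<And>n. (X n, Z n) \<in> L" "\<And>n. (Z n, Y n) \<in> L" by metis
  have form: "rip (Y m - Y n) (X m - X n) = (norm (Z m - Z n))\<^sup>2" for m n
    by (rule root_form[OF L]) (intro subspace_pair_diff positive_sa_relD(2)[OF L] Z)+
  have "Cauchy Z"
  proof (rule CauchyI)
    fix e :: real
    assume e: "0 < e"
    then have "0 < e\<^sup>2" by simp
    then obtain N where N: "\<And>m n. m \<ge> N \<Longrightarrow> n \<ge> N \<Longrightarrow> (norm (Z m - Z n))\<^sup>2 < e\<^sup>2"
      using XY unfolding form_approx_def form by meson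
    then have "norm (Z m - Z n) < e" if "m \<ge> N" "n \<ge> N" for m n
      using power_less_imp_less_base[OF N[OF that]] e by simp
    then show "\<exists>M. \<forall>m\<ge>M. \<forall>n\<ge>M. norm (Z m - Z n) < e" by blast
  qed
  then obtain l where l: "Z \<longlonglongrightarrow> l"
    using Cauchy_convergent convergent_def by blast
  have ul: "(u, l) \<in> L"
    using XY by (intro positive_sa_rel_closed[OF L Z(1) _ l]) (simp add: form_approx_def)
  have "(\<lambda>n. rip (Y n) (X n)) \<longlonglongrightarrow> rip g u"
    by (rule friedrichs_form_limit[OF G adj XY XY])
  moreover have "(\<lambda>n. rip (Y n) (X n)) \<longlonglongrightarrow> (norm l)\<^sup>2"
    unfolding root_form[OF L Z] by (intro tendsto_intros l)
  ultimately have "(norm l)\<^sup>2 = rip g u"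
    using LIMSEQ_unique by blast
  with ul show ?thesis by (rule that)
qed

text \<open>
  The roots \<open>K\<close> and \<open>L\<close> have values of equal norm on the domain of Friedrichs' extension, a core of \<open>K\<close>.
  Approximation from this core makes the values of \<open>L\<close> Cauchy along with those of \<open>K\<close>, and closedness
  of \<open>L\<close> finishes the argument.
\<close>

theorem friedrichs_root_maximal:
  assumes G: "positive_rel G" and dense: "closure (Domain G) = UNIV"
    and K: "positive_sa_rel K" "K O K = friedrichs G"
    and L: "positive_sa_rel L" "G \<subseteq> L O L"
    and hk: "(h, k) \<in> K"
  obtains l where "(h, l) \<in> L" "norm l = norm k"
proof -
  have "Domain G \<subseteq> Domain K" "Domain G \<subseteq> Domain L"
    using friedrichs_extends[OF G] L(2) unfolding K(2)[symmetric] by blast+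
  then have denseK: "closure (Domain K) = UNIV" and denseL: "closure (Domain L) = UNIV"
    by (metis closure_mono dense top.extremum_uniqueI)+
  have on_domain: "\<exists>l. (u, l) \<in> L \<and> norm l = norm v"
    if uv: "(u, v) \<in> K" and u: "u \<in> Domain (friedrichs G)" for u v
  proof -
    obtain g where g: "(u, g) \<in> friedrichs G" using u by blast
    then obtain v' where v': "(u, v') \<in> K" "(v', g) \<in> K" unfolding K(2)[symmetric] by blast
    have "rip g u = (norm v)\<^sup>2"
      using root_form[OF K(1) v'] dense_single_valued[OF K(1) denseK uv v'(1)] by simp
    moreover obtain l where "(u, l) \<in> L" "(norm l)\<^sup>2 = rip g u"
      using friedrichs_form_eq[OF G L g] .
    ultimately show ?thesis by auto
  qed
  obtain U V where UV: "\<And>n. (U n, V n) \<in> K" "\<And>n. U n \<in> Domain (friedrichs G)"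
    "U \<longlonglongrightarrow> h" "V \<longlonglongrightarrow> k"
    using root_core[OF K(1) denseK hk] unfolding K(2) by blast
  obtain W where W: "\<And>n. (U n, W n) \<in> L" "\<And>n. norm (W n) = norm (V n)"
    using on_domain[OF UV(1,2)] by metis
  have dist_eq: "norm (W m - W n) = norm (V m - V n)" for m n
  proof -
    obtain g g' where "(U m, g) \<in> friedrichs G" "(U n, g') \<in> friedrichs G"
      using UV(2) by blast
    then have "U m - U n \<in> Domain (friedrichs G)"
      using subspace_pair_diff[OF subspace_friedrichs[OF G]] by blast
    moreover have "(U m - U n, V m - V n) \<in> K"
      by (intro subspace_pair_diff positive_sa_relD(2)[OF K(1)] UV)
    ultimately obtain l where l: "(U m - U n, l) \<in> L" "norm l = norm (V m - V n)"
      using on_domain by blast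
    have "(U m - U n, W m - W n) \<in> L"
      by (intro subspace_pair_diff positive_sa_relD(2)[OF L(1)] W)
    then show ?thesis
      using dense_single_valued[OF L(1) denseL l(1)] l(2) by simp
  qed
  have "Cauchy V"
    using UV(4) convergent_Cauchy convergent_def by blast
  then have "Cauchy W"
    by (simp add: Cauchy_iff dist_eq)
  then obtain l where l: "W \<longlonglongrightarrow> l"
    using Cauchy_convergent convergent_def by blast
  have "(\<lambda>n. norm (V n)) \<longlonglongrightarrow> norm l"
    using tendsto_norm[OF l] by (simp add: W(2))
  then have "norm l = norm k"
    using tendsto_norm[OF UV(4)] LIMSEQ_unique by blast
  moreover have "(h, l) \<in> L"
    by (rule positive_sa_rel_closed[OF L(1) W(1) UV(3) l])
  ultimately show ?thesis using that by blast
qed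

end


section \<open>Operators over the scalar field as real linear relations\<close>

lemma graph_inj: "Map.graph S = Map.graph T \<longleftrightarrow> S = T"
proof
  assume eq: "Map.graph S = Map.graph T"
  have "S x = Some y \<longleftrightarrow> T x = Some y" for x y
    using eq by (metis in_graphI in_graphD)
  then show "S = T"
    by (intro ext) (metis option.exhaust)
qed simp

lemma in_graph_iff: "(x, y) \<in> Map.graph T \<longleftrightarrow> T x = Some y"
  by (auto intro: in_graphI dest: in_graphD)

lemma graph_subset_iff: "Map.graph S \<subseteq> Map.graph T \<longleftrightarrow> S \<subseteq>\<^sub>m T"
  by (auto simp: map_le_def in_graph_iff subset_iff dom_def)

lemma Domain_graph: "Domain (Map.graph T) = dom T"
  by (auto simp: in_graph_iff)

lemma single_valued_graph:
  assumes "\<And>x y y'. (x, y) \<in> R \<Longrightarrow> (x, y') \<in> R \<Longrightarrow> y = y'"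
  obtains T where "Map.graph T = R"
proof (rule that)
  show "Map.graph (\<lambda>x. if x \<in> Domain R then Some (THE y. (x, y) \<in> R) else None) = R"
  proof (intro equalityI subrelI)
    fix x y
    assume "(x, y) \<in> R"
    moreover from this have "(THE y. (x, y) \<in> R) = y"
      using assms by blast
    ultimately show "(x, y) \<in> Map.graph (\<lambda>x. if x \<in> Domain R then Some (THE y. (x, y) \<in> R) else None)"
      by (auto simp: in_graph_iff)
  next
    fix x y
    assume "(x, y) \<in> Map.graph (\<lambda>x. if x \<in> Domain R then Some (THE y. (x, y) \<in> R) else None)"
    then have "x \<in> Domain R" "y = (THE y. (x, y) \<in> R)"
      by (auto simp: in_graph_iff split: if_splits)
    moreover from this obtain y' where "(x, y') \<in> R" by blast
    moreover from this have "(THE y. (x, y) \<in> R) = y'"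
      using assms by blast
    ultimately show "(x, y) \<in> R" by simp
  qed
qed

context hilbert_space
begin

lemma ip_add_right: "ip z (x + y) = ip z x + ip z y"
  by (metis ip_sconj ip_add_left sconj_add)

lemma ip_scale_right: "ip x (smul c y) = sconj c * ip x y"
  by (metis ip_sconj ip_scale_left sconj_mult)

lemma ip_diff_left: "ip (x - y) z = ip x z - ip y z"
  by (metis add_diff_cancel_right' diff_add_cancel ip_add_left)

lemma ip_diff_right: "ip z (x - y) = ip z x - ip z y"
  by (metis add_diff_cancel_right' diff_add_cancel ip_add_right)

text \<open>
  The polarization identity gives the real part of the inner product without a real part function
  on the abstract scalar field.
\<close>

definition real_ip :: "'a \<Rightarrow> 'a \<Rightarrow> real" where
  "real_ip x y = ((norm (x + y))\<^sup>2 - (norm (x - y))\<^sup>2) / 4"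

lemma of_real_real_ip: "2 * of_real (real_ip x y) = ip x y + sconj (ip x y)"
proof -
  have "(of_real (4 * real_ip x y) :: 'k) = ip (x + y) (x + y) - ip (x - y) (x - y)"
    by (simp add: real_ip_def ip_self del: of_real_power)
  also have "\<dots> = 2 * (ip x y + ip y x)"
    by (simp add: ip_add_left ip_add_right ip_diff_left ip_diff_right)
  finally have "2 * (2 * of_real (real_ip x y)) = 2 * (ip x y + sconj (ip x y))"
    by (simp add: ip_sconj[of y x])
  then show ?thesis
    by (metis mult_left_cancel zero_neq_numeral)
qed

lemma real_ip_eqI: "2 * of_real r = ip x y + sconj (ip x y) \<Longrightarrow> real_ip x y = r"
  using of_real_real_ip[of x y] by (metis mult_left_cancel of_real_eq_iff zero_neq_numeral)

lemma smul_scaleR: "smul c (r *\<^sub>R x) = r *\<^sub>R smul c x"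
  by (simp flip: scale_of_real add: mult.commute)

sublocale re: real_hilbert real_ip
proof
  fix x y z :: 'a and r :: real
  show "real_ip (x + y) z = real_ip x z + real_ip y z"
    using of_real_real_ip[of x z] of_real_real_ip[of y z]
    by (intro real_ip_eqI) (simp add: ip_add_left sconj_add algebra_simps)
  show "real_ip (r *\<^sub>R x) y = r * real_ip x y"
    using of_real_real_ip[of x y]
    by (intro real_ip_eqI) (simp add: ip_scale_left sconj_mult sconj_of_real flip: scale_of_real
        distrib_left)
  show "real_ip x y = real_ip y x"
    by (simp add: real_ip_def norm_minus_commute add.commute)
  show "real_ip x x = (norm x)\<^sup>2"
    by (intro real_ip_eqI) (simp add: ip_self sconj_of_real del: of_real_power)
qed

lemma real_ip_smul: "real_ip (smul c x) y = real_ip x (smul (sconj c) y)"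
  using of_real_real_ip[of x "smul (sconj c) y"]
  by (intro real_ip_eqI) (simp add: ip_scale_left ip_scale_right sconj_sconj)

lemma sconj_smul_smul: "smul (sconj c) (smul c x) = (norm c)\<^sup>2 *\<^sub>R x"
  by (metis mult.commute mult_sconj scale_of_real scale_scale)

lemma bounded_linear_smul: "bounded_linear (smul c)"
proof (rule bounded_linear_intro[where K = "norm c"])
  fix x
  have "(norm (smul c x))\<^sup>2 = real_ip (smul c x) (smul c x)"
    by (simp add: re.rip_self)
  also have "\<dots> = real_ip x (smul (sconj c) (smul c x))"
    by (rule real_ip_smul)
  also have "\<dots> = (norm x * norm c)\<^sup>2"
    unfolding sconj_smul_smul
    by (simp add: re.rip_scaleR_right re.rip_self power_mult_distrib)
  finally show "norm (smul c x) \<le> norm x * norm c" by simp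
qed (simp_all add: scale_right_distrib smul_scaleR)

text \<open>
  If the difference \<open>d\<close> of the two inner products has the property that the real part of \<open>cd\<close> vanishes
  for all \<open>c\<close>, then the conjugate of \<open>d\<close> as \<open>c\<close> gives \<open>|d|\<^sup>2 = 0\<close>.
\<close>

lemma ip_eqI:
  assumes "\<And>c. real_ip (smul c x) y = real_ip (smul c x') y'"
  shows "ip x y = ip x' y'"
proof -
  define d where "d = ip x y - ip x' y'"
  have "c * d + sconj (c * d) = 0" for c
  proof -
    have "c * ip x y + sconj (c * ip x y) = c * ip x' y' + sconj (c * ip x' y')"
      using of_real_real_ip[of "smul c x" y] of_real_real_ip[of "smul c x'" y'] assms[of c]
      by (simp add: ip_scale_left)
    then show ?thesis
      using sconj_add[of "c * d" "c * ip x' y'"] by (simp add: d_def algebra_simps)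
  qed
  from this[of "sconj d"] have "2 * (d * sconj d) = 0"
    by (simp add: sconj_mult sconj_sconj mult.commute)
  then show ?thesis
    by (simp add: mult_sconj d_def)
qed

definition scalar_invariant :: "('a \<times> 'a) set \<Rightarrow> bool" where
  "scalar_invariant G \<longleftrightarrow> (\<forall>c. \<forall>(x, y)\<in>G. (smul c x, smul c y) \<in> G)"

lemma scalar_invariantD:
  "scalar_invariant G \<Longrightarrow> (x, y) \<in> G \<Longrightarrow> (smul c x, smul c y) \<in> G"
  by (auto simp: scalar_invariant_def)

text \<open>
  Scalar invariance allows \<open>(x, y)\<close> to be replaced by its multiples, so equality of real parts
  already gives equality of the scalar-valued inner products.
\<close>

lemma adjoint_rel_iff_ip:
  assumes "scalar_invariant G"
  shows "(u, v) \<in> re.adjoint_rel G \<longleftrightarrow> (\<forall>(x, y)\<in>G. ip y u = ip x v)"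
proof
  assume uv: "(u, v) \<in> re.adjoint_rel G"
  have "real_ip (smul c y) u = real_ip (smul c x) v" if "(x, y) \<in> G" for x y c
    using re.adjointD[OF uv scalar_invariantD[OF assms that]] .
  then show "\<forall>(x, y)\<in>G. ip y u = ip x v"
    by (auto intro!: ip_eqI)
next
  assume "\<forall>(x, y)\<in>G. ip y u = ip x v"
  then show "(u, v) \<in> re.adjoint_rel G"
    by (intro re.adjointI real_ip_eqI) (auto simp: of_real_real_ip)
qed

lemma linear_operator_iff:
  "linear_operator smul T \<longleftrightarrow>
     Real_Vector_Spaces.subspace (Map.graph T) \<and> scalar_invariant (Map.graph T)"
proof
  assume T: "linear_operator smul T"
  have sub: "0 \<in> dom T" "x \<in> dom T \<Longrightarrow> y \<in> dom T \<Longrightarrow> x + y \<in> dom T" "x \<in> dom T \<Longrightarrow> smul c x \<in> dom T"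
    for x y c
    using T by (auto simp: linear_operator_def subspace_def)
  have add: "T (x + x') = Some (y + y')" if xy: "T x = Some y" "T x' = Some y'" for x y x' y'
  proof -
    have "x \<in> dom T" "x' \<in> dom T" using xy by auto
    then have "the (T (x + x')) = the (T x) + the (T x')" "x + x' \<in> dom T"
      using T sub by (auto simp: linear_operator_def)
    then show ?thesis using xy by auto
  qed
  have scale: "T (smul c x) = Some (smul c y)" if xy: "T x = Some y" for c x y
  proof -
    have "x \<in> dom T" using xy by auto
    then have "the (T (smul c x)) = smul c (the (T x))" "smul c x \<in> dom T"
      using T sub by (auto simp: linear_operator_def)
    then show ?thesis using xy by auto
  qed
  obtain y where "T 0 = Some y" using sub(1) by blast
  from scale[OF this, of 0] have zero: "T 0 = Some 0" by simp
  show "Real_Vector_Spaces.subspace (Map.graph T) \<and> scalar_invariant (Map.graph T)"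
    using zero add scale
    by (auto simp: Real_Vector_Spaces.subspace_def scalar_invariant_def in_graph_iff zero_prod_def
        simp flip: scale_of_real)
next
  assume G: "Real_Vector_Spaces.subspace (Map.graph T) \<and> scalar_invariant (Map.graph T)"
  have zero: "T 0 = Some 0"
    using G Real_Vector_Spaces.subspace_0[of "Map.graph T"] by (simp add: zero_prod_def in_graph_iff)
  have add: "T (x + x') = Some (y + y')" if "T x = Some y" "T x' = Some y'" for x y x' y'
    using that re.subspace_pair_add[of "Map.graph T"] G by (simp add: in_graph_iff)
  have scale: "T (smul c x) = Some (smul c y)" if "T x = Some y" for c x y
    using that G scalar_invariantD[of "Map.graph T" x y c] by (simp add: in_graph_iff)
  show "linear_operator smul T"
    unfolding linear_operator_def subspace_def
    using zero add scale by fastforce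
qed

lemma positive_symmetric_iff:
  "positive_symmetric smul ip T \<longleftrightarrow>
     re.positive_rel (Map.graph T) \<and> scalar_invariant (Map.graph T)"
proof
  assume T: "positive_symmetric smul ip T"
  then have lin: "Real_Vector_Spaces.subspace (Map.graph T)" and inv: "scalar_invariant (Map.graph T)"
    by (simp_all add: positive_symmetric_def linear_operator_iff)
  have "Map.graph T \<subseteq> re.adjoint_rel (Map.graph T)"
  proof (rule subrelI)
    fix u v
    assume "(u, v) \<in> Map.graph T"
    then have "ip y u = ip x v" if "(x, y) \<in> Map.graph T" for x y
      using T that by (force simp: positive_symmetric_def in_graph_iff)
    then show "(u, v) \<in> re.adjoint_rel (Map.graph T)"
      by (auto simp: adjoint_rel_iff_ip[OF inv])
  qed
  moreover have "0 \<le> real_ip y x" if "(x, y) \<in> Map.graph T" for x y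
  proof -
    have x: "x \<in> dom T" "the (T x) = y"
      using that by (auto simp: in_graph_iff)
    have "\<forall>g\<in>dom T. \<exists>r\<ge>0. ip (the (T g)) g = of_real r"
      using T unfolding positive_symmetric_def by blast
    from bspec[OF this x(1)] obtain r where "0 \<le> r" "ip y x = of_real r"
      unfolding x(2) by blast
    then show ?thesis
      using real_ip_eqI[of r y x] by (simp add: sconj_of_real)
  qed
  ultimately show "re.positive_rel (Map.graph T) \<and> scalar_invariant (Map.graph T)"
    using lin inv by (auto simp: re.positive_rel_def)
next
  assume G: "re.positive_rel (Map.graph T) \<and> scalar_invariant (Map.graph T)"
  have sym: "ip y u = ip x v" if "T x = Some y" "T u = Some v" for x y u v
    using G that adjoint_rel_iff_ip[of "Map.graph T" u v]
    by (auto simp: re.positive_rel_def in_graph_iff subset_iff)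
  have "\<exists>r\<ge>0. ip y x = of_real r" if xy: "T x = Some y" for x y
  proof (intro exI conjI)
    show "0 \<le> real_ip y x"
      using G xy by (auto simp: re.positive_rel_def in_graph_iff)
    have "sconj (ip y x) = ip y x"
      using sym[OF xy xy] by (metis ip_sconj)
    then show "ip y x = of_real (real_ip y x)"
      using of_real_real_ip[of y x] by simp
  qed
  then show "positive_symmetric smul ip T"
    using G sym unfolding positive_symmetric_def linear_operator_iff re.positive_rel_def
    by (auto simp: dom_def)
qed

lemma graph_op_adjoint:
  assumes inv: "scalar_invariant (Map.graph T)" and dense: "densely_defined T"
  shows "Map.graph (op_adjoint ip T) = re.adjoint_rel (Map.graph T)"
proof -
  define P where "P h k \<longleftrightarrow> (\<forall>g\<in>dom T. ip (the (T g)) h = ip g k)" for h k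
  have adj: "(h, k) \<in> re.adjoint_rel (Map.graph T) \<longleftrightarrow> P h k" for h k
    unfolding adjoint_rel_iff_ip[OF inv] P_def by (force simp: in_graph_iff)
  have unique: "k = k'" if "P h k" "P h k'" for h k k'
  proof -
    have "(0, k - k') \<in> re.adjoint_rel (Map.graph T)"
      using re.subspace_pair_diff[OF re.subspace_adjoint, of h k "Map.graph T" h k'] that adj by simp
    then have "real_ip x (k - k') = 0" if "x \<in> dom T" for x
      using that by (auto dest!: re.adjointD simp: in_graph_iff re.rip.zero_right)
    then have "k - k' = 0"
      by (rule re.orthogonal_to_dense_eq_0[OF dense[unfolded densely_defined_def]])
    then show ?thesis by simp
  qed
  have "op_adjoint ip T h = Some k \<longleftrightarrow> P h k" for h k
  proof -
    have "(THE k. P h k) = k" if "P h k" for k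
      using that unique by blast
    then show ?thesis
      unfolding op_adjoint_def P_def[symmetric] by auto
  qed
  then show ?thesis
    by (auto simp: in_graph_iff adj)
qed

lemma positive_self_adjoint_iff:
  "positive_self_adjoint smul ip T \<longleftrightarrow>
     re.positive_sa_rel (Map.graph T) \<and> scalar_invariant (Map.graph T) \<and> densely_defined T"
  unfolding positive_self_adjoint_def self_adjoint_def positive_symmetric_iff re.positive_sa_rel_def
  by (metis graph_op_adjoint graph_inj linear_operator_iff re.positive_rel_def)

lemma positive_self_adjoint_of_rel:
  assumes R: "re.positive_sa_rel R" "scalar_invariant R" and dense: "closure (Domain R) = UNIV"
  obtains T where "positive_self_adjoint smul ip T" "Map.graph T = R"
proof -
  obtain T where T: "Map.graph T = R"
    using single_valued_graph re.dense_single_valued[OF R(1) dense] by metis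
  then have "densely_defined T"
    using dense by (simp add: densely_defined_def flip: Domain_graph)
  then show ?thesis
    using that[of T] R T by (simp add: positive_self_adjoint_iff)
qed

text \<open>
  The root of the graph of \<open>S\<close> inherits scalar invariance, and its domain contains the dense domain
  of \<open>S\<close>; so it is the graph of an operator, and uniqueness among relations gives uniqueness among
  operators.
\<close>

lemma op_sqrt:
  assumes S: "positive_self_adjoint smul ip S"
  shows "positive_self_adjoint smul ip (op_sqrt smul ip S)"
    and "op_sqrt smul ip S \<circ>\<^sub>m op_sqrt smul ip S = S"
proof -
  have S': "re.positive_sa_rel (Map.graph S)" "scalar_invariant (Map.graph S)"
    using S by (simp_all add: positive_self_adjoint_iff)
  obtain R where R: "re.positive_sa_rel R" "R O R = Map.graph S"
    and unique: "\<And>R'. re.positive_sa_rel R' \<Longrightarrow> R' O R' = Map.graph S \<Longrightarrow> R' = R"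
    and inv: "\<And>M x y. (\<And>x y. (x, y) \<in> Map.graph S \<Longrightarrow> (blinfun_apply M x, M y) \<in> Map.graph S) \<Longrightarrow>
        (x, y) \<in> R \<Longrightarrow> (M x, M y) \<in> R"
  proof (rule re.positive_sa_rel_root[OF S'(1)], goal_cases)
    case (1 R)
    from 1(2-5) show ?case by (rule 1(1))
  qed
  have "(smul c x, smul c y) \<in> R" if "(x, y) \<in> R" for c x y
    using inv[of "Blinfun (smul c)", OF _ that] S'(2)
    by (simp add: bounded_linear_Blinfun_apply[OF bounded_linear_smul] scalar_invariantD)
  then have "scalar_invariant R"
    by (auto simp: scalar_invariant_def)
  moreover have "closure (Domain R) = UNIV"
  proof -
    have "dom S \<subseteq> Domain R"
      unfolding Domain_graph[symmetric] R(2)[symmetric] by blast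
    then show ?thesis
      using S closure_mono[of "dom S" "Domain R"]
      by (simp add: positive_self_adjoint_iff densely_defined_def top.extremum_unique)
  qed
  ultimately obtain Q where Q: "positive_self_adjoint smul ip Q" "Map.graph Q = R"
    using positive_self_adjoint_of_rel R(1) by blast
  have "\<exists>!Q. positive_self_adjoint smul ip Q \<and> Q \<circ>\<^sub>m Q = S"
  proof (rule ex1I[of _ Q])
    show "positive_self_adjoint smul ip Q \<and> Q \<circ>\<^sub>m Q = S"
      using Q R(2) by (simp flip: graph_inj)
    fix Q'
    assume "positive_self_adjoint smul ip Q' \<and> Q' \<circ>\<^sub>m Q' = S"
    then have "Map.graph Q' = R"
      by (intro unique) (auto simp: positive_self_adjoint_iff)
    then show "Q' = Q"
      using Q(2) by (simp flip: graph_inj)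
  qed
  from theI'[OF this, folded op_sqrt_def]
  show "positive_self_adjoint smul ip (op_sqrt smul ip S)"
    "op_sqrt smul ip S \<circ>\<^sub>m op_sqrt smul ip S = S"
    by blast+
qed

lemma scalar_invariant_friedrichs:
  assumes G: "re.positive_rel G" and inv: "scalar_invariant G"
  shows "scalar_invariant (re.friedrichs G)"
proof -
  note smul_apply = bounded_linear_Blinfun_apply[OF bounded_linear_smul]
  have "(smul c u, smul c g) \<in> re.friedrichs G" if "(u, g) \<in> re.friedrichs G" for c u g
    using re.friedrichs_invariant[OF G, where M = "Blinfun (smul c)" and N = "Blinfun (smul (sconj c))"
        and K = "(norm c)\<^sup>2"] that inv
    by (simp add: smul_apply scalar_invariantD real_ip_smul sconj_sconj sconj_smul_smul
        del: scale_scale)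
  then show ?thesis by (auto simp: scalar_invariant_def)
qed

lemma form_le_friedrichs:
  assumes T: "positive_symmetric smul ip T" "densely_defined T"
    and F: "positive_self_adjoint smul ip F" "Map.graph F = re.friedrichs (Map.graph T)"
    and S: "positive_self_adjoint smul ip S" "T \<subseteq>\<^sub>m S"
  shows "form_le smul ip S F"
proof -
  let ?K = "op_sqrt smul ip F" and ?L = "op_sqrt smul ip S"
  have K: "re.positive_sa_rel (Map.graph ?K)" "Map.graph ?K O Map.graph ?K = re.friedrichs (Map.graph T)"
    using op_sqrt[OF F(1)] F(2) by (simp_all add: positive_self_adjoint_iff flip: graph_map_comp)
  have L: "re.positive_sa_rel (Map.graph ?L)" "Map.graph T \<subseteq> Map.graph ?L O Map.graph ?L"
    using op_sqrt[OF S(1)] S(2) graph_subset_iff[of T S]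
    by (simp_all add: positive_self_adjoint_iff flip: graph_map_comp)
  have G: "re.positive_rel (Map.graph T)" "closure (Domain (Map.graph T)) = UNIV"
    using T by (simp_all add: positive_symmetric_iff densely_defined_def Domain_graph)
  have "\<exists>l. ?L h = Some l \<and> norm l = norm k" if "?K h = Some k" for h k
    using re.friedrichs_root_maximal[OF G K L] that unfolding in_graph_iff by metis
  then show ?thesis
    unfolding form_le_def by fastforce
qed

end

theorem theorem3p1:
  fixes smul :: "'k::rc_field \<Rightarrow> 'a::banach \<Rightarrow> 'a"
    and ip :: "'a \<Rightarrow> 'a \<Rightarrow> 'k"
    and T :: "'a \<rightharpoonup> 'a"
  assumes "hilbert_space smul ip"
    and "positive_symmetric smul ip T"
    and "densely_defined T"
  shows "\<exists>T\<^sub>F. positive_self_adjoint smul ip T\<^sub>F \<and> T \<subseteq>\<^sub>m T\<^sub>F \<and>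
           (\<forall>S. positive_self_adjoint smul ip S \<and> T \<subseteq>\<^sub>m S \<longrightarrow> form_le smul ip S T\<^sub>F)"
proof -
  interpret hilbert_space smul ip by fact
  let ?G = "Map.graph T"
  have G: "re.positive_rel ?G" "scalar_invariant ?G"
    using assms(2) by (simp_all add: positive_symmetric_iff)
  have sub: "?G \<subseteq> re.friedrichs ?G"
    by (rule re.friedrichs_extends[OF G(1)])
  have "closure (Domain (re.friedrichs ?G)) = UNIV"
    using assms(3) closure_mono[OF Domain_mono[OF sub]]
    by (simp add: densely_defined_def Domain_graph top.extremum_unique)
  then obtain F where F: "positive_self_adjoint smul ip F" "Map.graph F = re.friedrichs ?G"
    using positive_self_adjoint_of_rel re.positive_sa_rel_friedrichs scalar_invariant_friedrichs G
    by metis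
  show ?thesis
  proof (intro exI[of _ F] conjI allI impI)
    show "T \<subseteq>\<^sub>m F"
      using sub by (simp flip: graph_subset_iff F(2))
    show "form_le smul ip S F" if "positive_self_adjoint smul ip S \<and> T \<subseteq>\<^sub>m S" for S
      using form_le_friedrichs[OF assms(2,3) F] that by blast
  qed (rule F)
qed

end
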